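(* Let $g\colon U\to V$ be a morphism of associative algebras over a field of characteristic $0$, $T=U\oplus V$, and let $\theta\in C^{n-1}_{\mathbf{As}_{B\to W}}(T;T)$ and $\omega\in C^{m-1}_{\mathbf{As}_{B\to W}}(T;T)$ correspond to $(\theta_U,\theta_V,\theta_g)\in C^n_{GS}(g;g)$ and $(\omega_U,\omega_V,\omega_g)\in C^m_{GS}(g;g)$ respectively. Then $l_2(\theta,\omega)\in C^{(n+m-1)-1}_{\mathbf{As}_{B\to W}}(T;T)$ is given by $$l_2(\theta,\omega)(\mu_{n+m-1})=-\sum_{s=1}^n(-1)^{(s+1)(m+1)}\theta_U\circ_s\omega_U-(-1)^{n+m}\sum_{s=1}^m(-1)^{(s+1)(n+1)}\omega_U\circ_s\theta_U,$$ $$l_2(\theta,\omega)(\nu_{n+m-1})=-\sum_{s=1}^n(-1)^{(s+1)(m+1)}\theta_V\circ_s\omega_V-(-1)^{n+m}\sum_{s=1}^m(-1)^{(s+1)(n+1)}\omega_V\circ_s\theta_V,$$ $$\begin{aligned}l_2(\theta,\omega)(f_{n+m-2})={}&-\sum_{s=1}^{n-1}(-1)^{(s+1)(m+1)}\theta_g\circ_s\omega_U-(-1)^{n+m}\sum_{s=1}^{m-1}(-1)^{(s+1)(n+1)}\omega_g\circ_s\theta_U\\&+(-1)^n\sum_{i=1}^n(-1)^{(i-1)m}\theta_V\circ_i\omega_g+\sum_{j=1}^m(-1)^{jn}\omega_V\circ_j\theta_g\\&+(-1)^{nm+n+m}\theta_g\smile\omega_g+(-1)^{nm}\omega_g\s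mile\theta_g.\end{aligned}$$
   Context: $\mathbf k$ is a field of characteristic $0$; $(U,\mu_U)$, $(V,\mu_V)$ are associative $\mathbf k$-algebras and $g\colon U\to V$ an algebra morphism. $T=U\oplus V$ is two-colored with $T_B=U$, $T_W=V$; $\mathrm{End}_T$ is its 2-colored endomorphism PROP (multilinear maps between tensor products of $U$'s and $V$'s). **Minimal model.** $\mathbf{As}_{B\to W}$ is the 2-colored operad whose algebras are morphisms of associative algebras. Its minimal model is $(\mathsf F(E),\partial)$, the free 2-colored PROP on the 2-colored $\Sigma$-bimodule $E$ freely generated by $\mu_n\colon B^{\otimes n}\to B$ of degree $n-2$ ($n\ge2$), $\nu_n\colon W^{\otimes n}\to W$ of degree $n-2$ ($n\ge2$), $f_n\colon B^{\otimes n}\to W$ of degree $n-1$ ($n\ge1$), with $$\partial(\mu_n)=\sum_{\substack{i+j=n+1\\ i,j\ge2}}\sum_{s=0}^{n-j}(-1)^{i+s(j+1)}\mu_i\circ_{s+1}\mu_j,\qquad \partial(\nu_n)=\sum_{\substack{i+j=n+1\\ i,j\ge2}}\sum_{s=0}^{n-j}(-1)^{i+s(j+1)}\nu_i\circ_{s+1}\nu_j,$$ $$\partial(f_n)=-\sum_{l=2}^n\sum_{r_1+\cdots+r_l=n}(-1)^{\sum_{1\le i<j\le l}r_i(r_j+1)}\nu_l(f_{r_1}\otimes\cdots\otimes f_{r_l})-\sum_{\substack{i+j=n+1\\ i\ge1,j\ge2}}\sum_{s=0}^{n-j}(-1)^{i+s(j+1)}f_i\circ_{s+1}\mu_j.$$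 The morphism $g$ corresponds to $\beta\colon\mathsf F(E)\to\mathrm{End}_T$ with $\beta(\mu_2)=\mu_U$, $\beta(\nu_2)=\mu_V$, $\beta(f_1)=g$, and $\beta=0$ on all other generators $\mu_n,\nu_n,f_n$. **Deformation complex.** $C^*_{\mathbf{As}_{B\to W}}(T;T)\cong\,\uparrow\mathrm{Hom}_\Sigma(E,\mathrm{End}_T)^{-*}$ ($\uparrow$ suspension, $-*$ reversed grading): an element $\theta\in C^{p}$ ($p\ge1$), of degree $|\theta|=p$, is a color-preserving equivariant linear map $E\to\mathrm{End}_T$ supported on generators of degree $p-1$. It is identified with $(\theta_U,\theta_V,\theta_g):=(\theta(\mu_{p+1}),\theta(\nu_{p+1}),\theta(f_p))\in C^{p+1}_{GS}(g;g)$, where $C^n_{GS}(g;g)=\mathrm{Hom}(U^{\otimes n},U)\oplus\mathrm{Hom}(V^{\otimes n},V)\oplus\mathrm{Hom}(U^{\otimes n-1},V)$. In the claim $n,m\ge2$. **Operations $l_k$.** For cochains $F_1,\ldots,F_k$ and a generator $\xi$, write $\partial(\xi)=\sum_s\Gamma_s$ as a sum of $E$-decorated graphs (as displayed). Then $$l_k(F_1,\ldots,F_k)(\xi)=(-1)^{\nu(F_1,\ldots,F_k)}\sum_s\sum_{(v_1,\ldots,v_k)}\gamma\big(\Gamma_s^{\{v_1,\ldots,v_k\}}[F_1,\ldots,F_k]\big),\qquad \nu(F_1,\ldots,F_k)=(k-1)|F_1|+(k-2)|F_2|+\cdots+|F_{k-1}|,$$ where $(v_1,\ldots,v_k)$ runs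 over all $k$-tuples of distinct vertices of $\Gamma_s$, the graph $\Gamma_s^{\{v_1,\ldots,v_k\}}[F_1,\ldots,F_k]$ is obtained by replacing the decoration $e_{v_i}$ of $v_i$ by $F_i(e_{v_i})$ and every other decoration $e_v$ by $\beta(e_v)$, and $\gamma$ is the resulting composite in $\mathrm{End}_T$. The only signs are the displayed ones and the coefficients in $\partial(\xi)$. **Notation.** $x\circ_sy$ plugs $y$ into the $s$-th input of $x$ (with identities in the other inputs); except that $\theta_V\circ_i\omega_g=\theta_V(g^{\otimes i-1}\otimes\omega_g\otimes g^{\otimes n-i})$ and $\omega_V\circ_j\theta_g=\omega_V(g^{\otimes j-1}\otimes\theta_g\otimes g^{\otimes m-j})$. Also $\theta_g\smile\omega_g=\mu_V(\theta_g\otimes\omega_g)$ and $\omega_g\smile\theta_g=\mu_V(\omega_g\otimes\theta_g)$. *)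

theory Defs
  imports
    Complex_Main
    "HOL-Library.Product_Plus"
    "HOL-Library.Poly_Mapping"
    "HOL-Combinatorics.Permutations"
begin

text \<open>Associative algebras are not assumed to have a unit: the class \<open>ring\<close> provides an
  associative biadditive product only.\<close>

locale assoc_algebra = vector_space scale
  for scale :: "'k::field \<Rightarrow> 'a::ring \<Rightarrow> 'a" +
  assumes scale_mult_left: "scale c x * y = scale c (x * y)"
    and scale_mult_right: "x * scale c y = scale c (x * y)"

locale algebra_morphism =
  U: assoc_algebra sU + V: assoc_algebra sV + Vector_Spaces.linear sU sV g
  for sU :: "'k::field \<Rightarrow> 'u::ring \<Rightarrow> 'u"
    and sV :: "'k \<Rightarrow> 'v::ring \<Rightarrow> 'v"
    and g :: "'u \<Rightarrow> 'v" +
  assumes map_mult: "g (x * y) = g x * g y"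

text \<open>Linear maps out of an \<open>n\<close>-fold tensor power are \<open>n\<close>-linear maps, represented as functions on
  lists that vanish on lists of any length other than \<open>n\<close>.\<close>

definition multilinear ::
  "('k::field \<Rightarrow> 'a::ab_group_add \<Rightarrow> 'a) \<Rightarrow> ('k \<Rightarrow> 'b::ab_group_add \<Rightarrow> 'b) \<Rightarrow> nat \<Rightarrow> ('a list \<Rightarrow> 'b) \<Rightarrow> bool"
  where "multilinear s1 s2 n \<phi> \<longleftrightarrow>
    (\<forall>xs. length xs \<noteq> n \<longrightarrow> \<phi> xs = 0) \<and>
    (\<forall>xs i. length xs = n \<and> i < n \<longrightarrow> Vector_Spaces.linear s1 s2 (\<lambda>x. \<phi> (xs[i := x])))"


section \<open>The endomorphism PROP\<close>

datatype color = B | W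

text \<open>\<open>T = U \<oplus> V\<close> is the product type. A linear map
  \<open>T\<^sub>c\<^sub>1 \<otimes> \<dots> \<otimes> T\<^sub>c\<^sub>n \<rightarrow> T\<^sub>d\<close> is extended by zero to the other summands of the \<open>n\<close>-th tensor
  power of \<open>T\<close>. Only components with a single output are needed, since all generators of the
  minimal model have a single output.\<close>

definition scaleT :: "('k \<Rightarrow> 'u \<Rightarrow> 'u) \<Rightarrow> ('k \<Rightarrow> 'v \<Rightarrow> 'v) \<Rightarrow> 'k \<Rightarrow> 'u \<times> 'v \<Rightarrow> 'u \<times> 'v"
  where "scaleT sU sV c = map_prod (sU c) (sV c)"

fun proj :: "color \<Rightarrow> 'u::zero \<times> 'v::zero \<Rightarrow> 'u \<times> 'v" where
  "proj B (u, v) = (u, 0)"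
| "proj W (u, v) = (0, v)"

type_synonym 't endo = "'t list \<Rightarrow> 't"

definition End_T ::
  "('k::field \<Rightarrow> 'u::ab_group_add \<Rightarrow> 'u) \<Rightarrow> ('k \<Rightarrow> 'v::ab_group_add \<Rightarrow> 'v) \<Rightarrow>
    color list \<Rightarrow> color \<Rightarrow> ('u \<times> 'v) endo set"
  where "End_T sU sV cs d = {\<phi>.
    multilinear (scaleT sU sV) (scaleT sU sV) (length cs) \<phi> \<and>
    (\<forall>xs. length xs = length cs \<longrightarrow> \<phi> (map2 proj cs xs) = \<phi> xs) \<and>
    (\<forall>xs. proj d (\<phi> xs) = \<phi> xs)}"

text \<open>The right action of a permutation on the inputs:
  \<open>(\<phi> \<sigma>)(x\<^sub>1, \<dots>, x\<^sub>n) = \<phi>(x\<^sub>\<tau>\<^sub>1, \<dots>, x\<^sub>\<tau>\<^sub>n)\<close> with \<open>\<tau> = inv \<sigma>\<close>.\<close>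

definition act_End :: "'t endo \<Rightarrow> (nat \<Rightarrow> nat) \<Rightarrow> 't endo"
  where "act_End \<phi> \<sigma> xs = \<phi> (permute_list (inv \<sigma>) xs)"

text \<open>The identifications of \<open>Hom(U\<^sup>n, U)\<close>, \<open>Hom(V\<^sup>n, V)\<close> and \<open>Hom(U\<^sup>n, V)\<close> (tensor powers) with
  components of \<open>End_T\<close>.\<close>

definition emb_UU :: "('u list \<Rightarrow> 'u) \<Rightarrow> ('u \<times> 'v::zero) endo"
  where "emb_UU \<phi> xs = (\<phi> (map fst xs), 0)"

definition emb_VV :: "('v list \<Rightarrow> 'v) \<Rightarrow> ('u::zero \<times> 'v) endo"
  where "emb_VV \<phi> xs = (0, \<phi> (map snd xs))"

definition emb_UV :: "('u list \<Rightarrow> 'v) \<Rightarrow> ('u::zero \<times> 'v) endo"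
  where "emb_UV \<phi> xs = (0, \<phi> (map fst xs))"


section \<open>The generating bimodule\<close>

datatype gen = Mu nat | Nu nat | Ff nat

definition generators :: "gen set"
  where "generators = Mu ` {2..} \<union> Nu ` {2..} \<union> Ff ` {1..}"

fun inputs :: "gen \<Rightarrow> color list" where
  "inputs (Mu n) = replicate n B"
| "inputs (Nu n) = replicate n W"
| "inputs (Ff n) = replicate n B"

fun out_color :: "gen \<Rightarrow> color" where
  "out_color (Mu n) = B"
| "out_color (Nu n) = W"
| "out_color (Ff n) = W"

abbreviation arity :: "gen \<Rightarrow> nat"
  where "arity e \<equiv> length (inputs e)"

fun degree :: "gen \<Rightarrow> nat" where
  "degree (Mu n) = n - 2"
| "degree (Nu n) = n - 2"
| "degree (Ff n) = n - 1"

text \<open>The free bimodule on the generators has as basis the pairs \<open>(e, \<sigma>)\<close>, standing for \<open>e\<close> acted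
  on from the right by the permutation \<open>\<sigma>\<close> of its inputs. The inputs of a generator all have the
  same color, so this action preserves the colors. The left action is trivial because every
  generator has exactly one output.\<close>

type_synonym 'k bimod = "(gen \<times> (nat \<Rightarrow> nat)) \<Rightarrow>\<^sub>0 'k"

definition E :: "color list \<Rightarrow> color \<Rightarrow> 'k::field bimod set"
  where "E cs d = {x. Poly_Mapping.keys x \<subseteq>
    {(e, \<sigma>). e \<in> generators \<and> \<sigma> permutes {..<arity e} \<and> inputs e = cs \<and> out_color e = d}}"

definition act_E :: "'k::field bimod \<Rightarrow> (nat \<Rightarrow> nat) \<Rightarrow> 'k bimod"
  where "act_E x \<tau> = (\<Sum>(e, \<sigma>)\<in>Poly_Mapping.keys x.
    Poly_Mapping.single (e, \<sigma> \<circ> \<tau>) (Poly_Mapping.lookup x (e, \<sigma>)))"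

definition gen_elt :: "gen \<Rightarrow> 'k::field bimod"
  where "gen_elt e = Poly_Mapping.single (e, id) 1"

text \<open>The equivariant linear extension of an assignment on generators.\<close>

definition extend ::
  "('k::field \<Rightarrow> 't \<Rightarrow> 't) \<Rightarrow> (gen \<Rightarrow> 't endo) \<Rightarrow> 'k bimod \<Rightarrow> 't::ab_group_add endo"
  where "extend s a x = (\<lambda>ts. \<Sum>(e, \<sigma>)\<in>Poly_Mapping.keys x.
    s (Poly_Mapping.lookup x (e, \<sigma>)) (act_End (a e) \<sigma> ts))"


section \<open>Decorated graphs and the differential\<close>

text \<open>All graphs occurring in the differential of a generator are planar trees whose leaves are
  numbered from left to right, so a graph is a planar tree with decorated vertices; \<open>Leaf\<close> is an
  input edge, whose color is determined by the vertex it enters. A vertex is named by its path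
  from the root.\<close>

datatype 'e tree = Leaf | Node 'e "'e tree list"

primrec leaves :: "'e tree \<Rightarrow> nat" where
  "leaves Leaf = 1"
| "leaves (Node e ts) = sum_list (map leaves ts)"

primrec vertices :: "'e tree \<Rightarrow> nat list set" where
  "vertices Leaf = {}"
| "vertices (Node e ts) = insert [] (\<Union>i<length ts. (#) i ` (map vertices ts ! i))"

primrec redecorate :: "'e tree \<Rightarrow> (nat list \<Rightarrow> 'e \<Rightarrow> 'f) \<Rightarrow> 'f tree" where
  "redecorate Leaf = (\<lambda>D. Leaf)"
| "redecorate (Node e ts) = (\<lambda>D. Node (D [] e)
    (map2 (\<lambda>i r. r (\<lambda>p. D (i # p))) [0..<length ts] (map redecorate ts)))"

primrec split_list_by :: "nat list \<Rightarrow> 'a list \<Rightarrow> 'a list list" where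
  "split_list_by [] xs = []"
| "split_list_by (n # ns) xs = take n xs # split_list_by ns (drop n xs)"

text \<open>The composite of a graph decorated by multilinear maps.\<close>

primrec gamma :: "'t::zero endo tree \<Rightarrow> 't endo" where
  "gamma Leaf = (\<lambda>xs. if length xs = 1 then hd xs else 0)"
| "gamma (Node \<phi> ts) = (\<lambda>xs. if length xs = sum_list (map leaves ts)
    then \<phi> (map2 (\<lambda>f ys. f ys) (map gamma ts) (split_list_by (map leaves ts) xs)) else 0)"

definition corolla :: "gen \<Rightarrow> gen tree"
  where "corolla e = Node e (replicate (arity e) Leaf)"

definition graft :: "gen \<Rightarrow> nat \<Rightarrow> gen \<Rightarrow> gen tree"
  where "graft e s e' =
    Node e (replicate (s - 1) Leaf @ corolla e' # replicate (arity e - s) Leaf)"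

abbreviation signed :: "nat \<Rightarrow> gen tree \<Rightarrow> gen tree \<Rightarrow>\<^sub>0 'k::field"
  where "signed a t \<equiv> Poly_Mapping.single t ((-1) ^ a)"

text \<open>A composition \<open>r\<^sub>1 + \<dots> + r\<^sub>l = n\<close> is the list of its parts, indexed from 0 by \<open>nth\<close>.\<close>

fun boundary :: "gen \<Rightarrow> gen tree \<Rightarrow>\<^sub>0 'k::field" where
  "boundary (Mu n) = (\<Sum>(i, j)\<in>{(i, j). i + j = n + 1 \<and> 2 \<le> i \<and> 2 \<le> j}. \<Sum>s=0..n - j.
     signed (i + s * (j + 1)) (graft (Mu i) (s + 1) (Mu j)))"
| "boundary (Nu n) = (\<Sum>(i, j)\<in>{(i, j). i + j = n + 1 \<and> 2 \<le> i \<and> 2 \<le> j}. \<Sum>s=0..n - j.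
     signed (i + s * (j + 1)) (graft (Nu i) (s + 1) (Nu j)))"
| "boundary (Ff n) =
     - (\<Sum>l=2..n. \<Sum>r\<in>{r. length r = l \<and> (\<forall>a\<in>set r. 1 \<le> a) \<and> sum_list r = n}.
          signed (\<Sum>(i, j)\<in>{(i, j). i < j \<and> j < l}. r ! i * (r ! j + 1))
            (Node (Nu l) (map (\<lambda>a. corolla (Ff a)) r)))
     - (\<Sum>(i, j)\<in>{(i, j). i + j = n + 1 \<and> 1 \<le> i \<and> 2 \<le> j}. \<Sum>s=0..n - j.
          signed (i + s * (j + 1)) (graft (Ff i) (s + 1) (Mu j)))"

fun beta_gen :: "('u \<Rightarrow> 'v) \<Rightarrow> gen \<Rightarrow> ('u::ring \<times> 'v::ring) endo" where
  "beta_gen g (Mu n) =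
     (if n = 2 then emb_UU (\<lambda>xs. if length xs = 2 then xs ! 0 * xs ! 1 else 0) else (\<lambda>_. 0))"
| "beta_gen g (Nu n) =
     (if n = 2 then emb_VV (\<lambda>xs. if length xs = 2 then xs ! 0 * xs ! 1 else 0) else (\<lambda>_. 0))"
| "beta_gen g (Ff n) =
     (if n = 1 then emb_UV (\<lambda>xs. if length xs = 1 then g (xs ! 0) else 0) else (\<lambda>_. 0))"

text \<open>The restriction to the bimodule \<open>E\<close> of the PROP morphism determined by \<open>g\<close>.\<close>

definition beta ::
  "('k::field \<Rightarrow> 'u::ring \<Rightarrow> 'u) \<Rightarrow> ('k \<Rightarrow> 'v::ring \<Rightarrow> 'v) \<Rightarrow> ('u \<Rightarrow> 'v) \<Rightarrow>
    'k bimod \<Rightarrow> ('u \<times> 'v) endo"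
  where "beta sU sV g = extend (scaleT sU sV) (beta_gen g)"


section \<open>The deformation complex and its operations\<close>

type_synonym ('k, 'u, 'v) cochain = "'k bimod \<Rightarrow> ('u \<times> 'v) endo"

definition def_complex ::
  "('k::field \<Rightarrow> 'u::ab_group_add \<Rightarrow> 'u) \<Rightarrow> ('k \<Rightarrow> 'v::ab_group_add \<Rightarrow> 'v) \<Rightarrow> nat \<Rightarrow>
    ('k, 'u, 'v) cochain set"
  where "def_complex sU sV p = {\<theta>.
    (\<forall>cs d. \<forall>x\<in>E cs d. \<theta> x \<in> End_T sU sV cs d) \<and>
    (\<forall>cs d. \<forall>x\<in>E cs d. \<forall>y\<in>E cs d. \<forall>ts. \<theta> (x + y) ts = \<theta> x ts + \<theta> y ts) \<and>
    (\<forall>cs d. \<forall>x\<in>E cs d. \<forall>c ts. \<theta> (Poly_Mapping.map ((*) c) x) ts = scaleT sU sV c (\<theta> x ts)) \<and>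
    (\<forall>cs d. \<forall>x\<in>E cs d. \<forall>\<tau>. \<tau> permutes {..<length cs} \<longrightarrow> \<theta> (act_E x \<tau>) = act_End (\<theta> x) \<tau>) \<and>
    (\<forall>e\<in>generators. degree e + 1 \<noteq> p \<longrightarrow> \<theta> (gen_elt e) = (\<lambda>_. 0))}"

definition C_GS ::
  "('k::field \<Rightarrow> 'u::ab_group_add \<Rightarrow> 'u) \<Rightarrow> ('k \<Rightarrow> 'v::ab_group_add \<Rightarrow> 'v) \<Rightarrow> nat \<Rightarrow>
    (('u list \<Rightarrow> 'u) \<times> ('v list \<Rightarrow> 'v) \<times> ('u list \<Rightarrow> 'v)) set"
  where "C_GS sU sV n =
    {(\<phi>, \<psi>, \<chi>). multilinear sU sU n \<phi> \<and> multilinear sV sV n \<psi> \<and> multilinear sU sV (n - 1) \<chi>}"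

definition corresponds ::
  "nat \<Rightarrow> ('k::field, 'u::ab_group_add, 'v::ab_group_add) cochain \<Rightarrow>
    ('u list \<Rightarrow> 'u) \<times> ('v list \<Rightarrow> 'v) \<times> ('u list \<Rightarrow> 'v) \<Rightarrow> bool"
  where "corresponds n \<theta> = (\<lambda>(\<phi>, \<psi>, \<chi>).
    \<theta> (gen_elt (Mu n)) = emb_UU \<phi> \<and>
    \<theta> (gen_elt (Nu n)) = emb_VV \<psi> \<and>
    \<theta> (gen_elt (Ff (n - 1))) = emb_UV \<chi>)"

text \<open>The arguments of \<open>l\<^sub>k\<close> are paired with their degrees, since a function does not determine its
  degree (it may be zero).\<close>

definition nu_exponent :: "(nat \<times> 'c) list \<Rightarrow> nat"
  where "nu_exponent Fs = (\<Sum>i<length Fs. (length Fs - 1 - i) * fst (Fs ! i))"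

definition substitute ::
  "('k::field \<Rightarrow> 'u::ring \<Rightarrow> 'u) \<Rightarrow> ('k \<Rightarrow> 'v::ring \<Rightarrow> 'v) \<Rightarrow> ('u \<Rightarrow> 'v) \<Rightarrow>
    (nat \<times> ('k, 'u, 'v) cochain) list \<Rightarrow> nat list list \<Rightarrow> gen tree \<Rightarrow> ('u \<times> 'v) endo tree"
  where "substitute sU sV g Fs vs \<Gamma> = redecorate \<Gamma> (\<lambda>v e.
    case map_of (zip vs (map snd Fs)) v of
      Some F \<Rightarrow> F (gen_elt e)
    | None \<Rightarrow> beta sU sV g (gen_elt e))"

definition l_gen ::
  "('k::field \<Rightarrow> 'u::ring \<Rightarrow> 'u) \<Rightarrow> ('k \<Rightarrow> 'v::ring \<Rightarrow> 'v) \<Rightarrow> ('u \<Rightarrow> 'v) \<Rightarrow>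
    (nat \<times> ('k, 'u, 'v) cochain) list \<Rightarrow> gen \<Rightarrow> ('u \<times> 'v) endo"
  where "l_gen sU sV g Fs \<xi> = (\<lambda>ts. scaleT sU sV ((-1) ^ nu_exponent Fs)
    (\<Sum>\<Gamma>\<in>Poly_Mapping.keys (boundary \<xi> :: gen tree \<Rightarrow>\<^sub>0 'k).
       scaleT sU sV (Poly_Mapping.lookup (boundary \<xi>) \<Gamma>)
         (\<Sum>vs | length vs = length Fs \<and> distinct vs \<and> set vs \<subseteq> vertices \<Gamma>.
            gamma (substitute sU sV g Fs vs \<Gamma>) ts)))"

definition l_op ::
  "('k::field \<Rightarrow> 'u::ring \<Rightarrow> 'u) \<Rightarrow> ('k \<Rightarrow> 'v::ring \<Rightarrow> 'v) \<Rightarrow> ('u \<Rightarrow> 'v) \<Rightarrow>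
    (nat \<times> ('k, 'u, 'v) cochain) list \<Rightarrow> ('k, 'u, 'v) cochain"
  where "l_op sU sV g Fs = extend (scaleT sU sV) (l_gen sU sV g Fs)"


section \<open>Partial compositions and cup products\<close>

text \<open>The number \<open>m\<close> is the arity of the inner map \<open>\<psi>\<close>; positions are counted from 1.\<close>

definition circ :: "('a list \<Rightarrow> 'b) \<Rightarrow> nat \<Rightarrow> nat \<Rightarrow> ('a list \<Rightarrow> 'a) \<Rightarrow> 'a list \<Rightarrow> 'b"
  where "circ \<phi> s m \<psi> xs =
    \<phi> (take (s - 1) xs @ \<psi> (take m (drop (s - 1) xs)) # drop (s - 1 + m) xs)"

definition circ_along ::
  "('u \<Rightarrow> 'v) \<Rightarrow> ('v list \<Rightarrow> 'v) \<Rightarrow> nat \<Rightarrow> nat \<Rightarrow> ('u list \<Rightarrow> 'v) \<Rightarrow> 'u list \<Rightarrow> 'v"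
  where "circ_along g \<phi> s m \<psi> xs =
    \<phi> (map g (take (s - 1) xs) @ \<psi> (take m (drop (s - 1) xs)) # map g (drop (s - 1 + m) xs))"

text \<open>Here \<open>a\<close> is the arity of the left factor \<open>\<phi>\<close>.\<close>

definition cup :: "nat \<Rightarrow> ('u list \<Rightarrow> 'v::times) \<Rightarrow> ('u list \<Rightarrow> 'v) \<Rightarrow> 'u list \<Rightarrow> 'v"
  where "cup a \<phi> \<psi> xs = \<phi> (take a xs) * \<psi> (drop a xs)"

end

theory Submission
  imports Defs
begin

text \<open>A cochain is supported on the generators of one degree, and \<open>\<beta>\<close> only on \<open>\<mu>\<^sub>2\<close>, \<open>\<nu>\<^sub>2\<close> and \<open>f\<^sub>1\<close>.
  Hence in a two-vertex term \<open>\<mu>\<^sub>i \<circ>\<^sub>s \<mu>\<^sub>j\<close>, \<open>\<nu>\<^sub>i \<circ>\<^sub>s \<nu>\<^sub>j\<close> or \<open>f\<^sub>i \<circ>\<^sub>s \<mu>\<^sub>j\<close> of the differential each of the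
  two ways of inserting \<open>\<theta>\<close> and \<open>\<omega>\<close> survives for exactly one pair \<open>(i, j)\<close>. In a term
  \<open>\<nu>\<^sub>l(f\<^sub>r\<^sub>1, \<dots>, f\<^sub>r\<^sub>l)\<close> there are two cases. If one cochain sits at the root, all children but one
  carry \<open>\<beta>\<close>, which forces the composition \<open>(1, \<dots>, 1, q, 1, \<dots>, 1)\<close> and gives the mixed terms
  \<open>\<theta>\<^sub>V \<circ>\<^sub>i \<omega>\<^sub>g\<close> and \<open>\<omega>\<^sub>V \<circ>\<^sub>j \<theta>\<^sub>g\<close>. If both sit at children, the root carries \<open>\<beta>\<close>, which forces
  \<open>l = 2\<close> and gives the two cup products. The remaining signs are parity computations.\<close>


section \<open>Linear extension\<close>

text \<open>Working with linear extensions lets the differential be evaluated summand by summand: it is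
  never needed that the graphs displayed in it are pairwise distinct.\<close>

definition lin_ext :: "('k::zero \<Rightarrow> 't \<Rightarrow> 't) \<Rightarrow> ('b \<Rightarrow> 't) \<Rightarrow> ('b \<Rightarrow>\<^sub>0 'k) \<Rightarrow> 't::comm_monoid_add"
  where "lin_ext s f x = (\<Sum>b\<in>Poly_Mapping.keys x. s (Poly_Mapping.lookup x b) (f b))"

lemma extend_eq_lin_ext:
  "extend s a x ts = lin_ext s (\<lambda>(e, \<sigma>). act_End (a e) \<sigma> ts) x"
  by (simp add: extend_def lin_ext_def case_prod_unfold)

text \<open>Supports of the cochains and of \<open>\<beta>\<close> leave a single candidate index in
  the sums over graphs. The conditional covers the case that this candidate lies outside the range
  of summation.\<close>

lemma sum_single_support:
  fixes f :: "'a \<Rightarrow> 'b::comm_monoid_add"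
  assumes "finite S" and "\<And>x. x \<in> S \<Longrightarrow> x \<noteq> a \<Longrightarrow> f x = 0"
  shows "sum f S = (if a \<in> S then f a else 0)"
proof -
  have "sum f S = (\<Sum>x\<in>S. if x = a then f a else 0)"
    using assms(2) by (intro sum.cong) auto
  then show ?thesis
    using assms(1) by simp
qed

context vector_space
begin

text \<open>Coefficients may cancel in a sum, so its keys are not determined by those of the
  summands. Enlarging the index set by zero terms makes additivity a termwise statement.\<close>

lemma lin_ext_superset:
  assumes "finite A" and "Poly_Mapping.keys x \<subseteq> A"
  shows "lin_ext scale f x = (\<Sum>b\<in>A. scale (Poly_Mapping.lookup x b) (f b))"
  unfolding lin_ext_def using assms
  by (intro sum.mono_neutral_left) (auto simp: in_keys_iff)

lemma lin_ext_0 [simp]: "lin_ext scale f 0 = 0"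
  by (simp add: lin_ext_def)

lemma lin_ext_single [simp]: "lin_ext scale f (Poly_Mapping.single b c) = scale c (f b)"
  by (simp add: lin_ext_def)

lemma lin_ext_add: "lin_ext scale f (x + y) = lin_ext scale f x + lin_ext scale f y"
proof -
  let ?A = "Poly_Mapping.keys x \<union> Poly_Mapping.keys y"
  have "lin_ext scale f z = (\<Sum>b\<in>?A. scale (Poly_Mapping.lookup z b) (f b))"
    if "Poly_Mapping.keys z \<subseteq> ?A" for z
    using that by (intro lin_ext_superset) auto
  then show ?thesis
    using Poly_Mapping.keys_add[of x y]
    by (simp add: lookup_add scale_left_distrib sum.distrib)
qed

lemma lin_ext_minus: "lin_ext scale f (- x) = - lin_ext scale f x"
  by (simp add: lin_ext_def sum_negf)

lemma lin_ext_diff: "lin_ext scale f (x - y) = lin_ext scale f x - lin_ext scale f y"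
  using lin_ext_add[of f x "- y"] by (simp add: lin_ext_minus)

lemma lin_ext_sum: "lin_ext scale f (\<Sum>a\<in>A. h a) = (\<Sum>a\<in>A. lin_ext scale f (h a))"
  by (induction A rule: infinite_finite_induct) (simp_all add: lin_ext_add)

lemma lin_ext_map_scale:
  "lin_ext scale f (Poly_Mapping.map ((*) c) x) = scale c (lin_ext scale f x)"
proof -
  \<comment> \<open>The inclusion can be strict, since \<open>c\<close> may be
    \<open>0\<close>.\<close>
  have "Poly_Mapping.keys (Poly_Mapping.map ((*) c) x) \<subseteq> Poly_Mapping.keys x"
    by (auto simp: in_keys_iff Poly_Mapping.map.rep_eq when_def split: if_splits)
  then have "lin_ext scale f (Poly_Mapping.map ((*) c) x) =
    (\<Sum>b\<in>Poly_Mapping.keys x. scale (Poly_Mapping.lookup (Poly_Mapping.map ((*) c) x) b) (f b))"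
    by (intro lin_ext_superset) auto
  also have "\<dots> = (\<Sum>b\<in>Poly_Mapping.keys x. scale c (scale (Poly_Mapping.lookup x b) (f b)))"
    by (intro sum.cong) (auto simp: Poly_Mapping.map.rep_eq when_def in_keys_iff)
  finally show ?thesis
    by (simp add: lin_ext_def scale_sum_right)
qed

text \<open>Only the parity of an exponent matters; parity of \<open>a + b\<close> compares the two
  exponents without subtraction.\<close>

lemma scale_minus_one_power_cong:
  assumes "even (a + b)"
  shows "scale ((-1) ^ a) x = scale ((-1) ^ b) x"
  using assms by (simp add: minus_one_power_iff)

lemma scale_minus_one_power_neg:
  assumes "odd (a + b)"
  shows "scale ((-1) ^ a) x = - scale ((-1) ^ b) x"
  using assms by (auto simp: minus_one_power_iff)

end


section \<open>Multilinear maps and composites of graphs\<close>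

lemma multilinear_wrong_length: "multilinear s1 s2 n \<phi> \<Longrightarrow> length xs \<noteq> n \<Longrightarrow> \<phi> xs = 0"
  by (simp add: multilinear_def)

lemma multilinear_linear:
  "multilinear s1 s2 n \<phi> \<Longrightarrow> length xs = n \<Longrightarrow> i < n \<Longrightarrow>
    Vector_Spaces.linear s1 s2 (\<lambda>x. \<phi> (xs[i := x]))"
  by (simp add: multilinear_def)

lemma linear_map_zero: "Vector_Spaces.linear s1 s2 f \<Longrightarrow> f 0 = 0"
  by (metis module_hom.zero module_hom_iff_linear)

lemma multilinear_zero_entry:
  assumes "multilinear s1 s2 n \<phi>" and "0 \<in> set xs"
  shows "\<phi> xs = 0"
proof (cases "length xs = n")
  case True
  obtain i where i: "i < length xs" "xs ! i = 0"
    using assms(2) by (metis in_set_conv_nth)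
  have "\<phi> (xs[i := 0]) = 0"
    using linear_map_zero[OF multilinear_linear[OF assms(1) True, of i]] i True by simp
  then show ?thesis
    using i by (metis list_update_id)
qed (use assms in \<open>simp add: multilinear_wrong_length\<close>)

context vector_space_pair
begin

lemma multilinear_zero: "multilinear s1 s2 n (\<lambda>_. 0)"
  by (simp add: multilinear_def linear_zero)

lemma multilinear_add:
  "multilinear s1 s2 n \<phi> \<Longrightarrow> multilinear s1 s2 n \<psi> \<Longrightarrow> multilinear s1 s2 n (\<lambda>xs. \<phi> xs + \<psi> xs)"
  by (simp add: multilinear_def linear_compose_add)

lemma multilinear_scale:
  "multilinear s1 s2 n \<phi> \<Longrightarrow> multilinear s1 s2 n (\<lambda>xs. s2 c (\<phi> xs))"
  by (simp add: multilinear_def linear_compose_scale_right)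

lemma multilinear_sum:
  "(\<And>a. a \<in> A \<Longrightarrow> multilinear s1 s2 n (\<phi> a)) \<Longrightarrow> multilinear s1 s2 n (\<lambda>xs. \<Sum>a\<in>A. \<phi> a xs)"
  by (induction A rule: infinite_finite_induct) (simp_all add: multilinear_zero multilinear_add)

end

section \<open>Distribution of inputs among subtrees, and multilinearity of composites\<close>

lemma length_split_list_by [simp]: "length (split_list_by ns xs) = length ns"
  by (induction ns arbitrary: xs) simp_all

lemma length_split_list_by_nth:
  "length xs = sum_list ns \<Longrightarrow> i < length ns \<Longrightarrow> length (split_list_by ns xs ! i) = ns ! i"
proof (induction ns arbitrary: xs i)
  case (Cons n ns)
  then show ?case by (cases i) auto
qed simp

lemma split_list_by_append:
  "split_list_by (ns @ ms) xs =
    split_list_by ns (take (sum_list ns) xs) @ split_list_by ms (drop (sum_list ns) xs)"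
  by (induction ns arbitrary: xs) (simp_all add: drop_take add.commute)

text \<open>The block containing position \<open>i\<close> and the offset inside it depend only on
  the block lengths. Hence the quantifier over \<open>x\<close> stands inside, and the update can be
  read as a function of \<open>x\<close>.\<close>

lemma split_list_by_update:
  assumes "length xs = sum_list ns" and "i < sum_list ns"
  shows "\<exists>k j. k < length ns \<and> j < ns ! k \<and> (\<forall>x. split_list_by ns (xs[i := x]) =
    (split_list_by ns xs)[k := (split_list_by ns xs ! k)[j := x]])"
  using assms
proof (induction ns arbitrary: xs i)
  case (Cons n ns)
  show ?case
  proof (cases "i < n")
    case True
    then show ?thesis
      by (intro exI[of _ 0] exI[of _ i]) (simp add: take_update_swap)
  next
    case False
    then have "\<exists>k j. k < length ns \<and> j < ns ! k \<and> (\<forall>x. split_list_by ns ((drop n xs)[i - n := x]) =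
        (split_list_by ns (drop n xs))[k := (split_list_by ns (drop n xs) ! k)[j := x]])"
      using Cons.prems by (intro Cons.IH) auto
    then obtain k j where "k < length ns" "j < ns ! k"
      "\<And>x. split_list_by ns ((drop n xs)[i - n := x]) =
        (split_list_by ns (drop n xs))[k := (split_list_by ns (drop n xs) ! k)[j := x]]"
      by blast
    then show ?thesis
      using False by (intro exI[of _ "Suc k"] exI[of _ j]) (simp add: drop_update_swap)
  qed
qed simp

lemma gamma_Node:
  "length xs = sum_list (map leaves ts) \<Longrightarrow>
    gamma (Node \<phi> ts) xs = \<phi> (map2 gamma ts (split_list_by (map leaves ts) xs))"
  by (simp add: zip_map1 case_prod_unfold comp_def)

lemma gamma_Node_nth:
  assumes "length xs = sum_list (map leaves ts)"
  shows "gamma (Node \<phi> ts) xs =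
    \<phi> (map (\<lambda>i. gamma (ts ! i) (split_list_by (map leaves ts) xs ! i)) [0..<length ts])"
proof -
  have "map2 gamma ts (split_list_by (map leaves ts) xs) =
      map (\<lambda>i. gamma (ts ! i) (split_list_by (map leaves ts) xs ! i)) [0..<length ts]"
    by (rule nth_equalityI) simp_all
  then show ?thesis
    by (simp only: gamma_Node[OF assms])
qed

lemma gamma_wrong_length: "length xs \<noteq> leaves t \<Longrightarrow> gamma t xs = 0"
  by (cases t) auto

text \<open>Changing one input changes the value of a single child, so the dependence on that input
  is a linear slot of the child followed by a linear slot of \<open>\<phi>\<close>.\<close>

lemma multilinear_gamma_Node:
  fixes s :: "'k::field \<Rightarrow> 'a::ab_group_add \<Rightarrow> 'a"
  assumes \<phi>: "multilinear s s (length ts) \<phi>"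
    and ts: "\<And>t. t \<in> set ts \<Longrightarrow> multilinear s s (leaves t) (gamma t)"
  shows "multilinear s s (leaves (Node \<phi> ts)) (gamma (Node \<phi> ts))"
  unfolding multilinear_def
proof (intro conjI allI impI)
  fix xs :: "'a list" and i
  assume "length xs \<noteq> leaves (Node \<phi> ts)"
  then show "gamma (Node \<phi> ts) xs = 0"
    by (rule gamma_wrong_length)
next
  fix xs :: "'a list" and i
  let ?ns = "map leaves ts"
  let ?ys = "split_list_by ?ns xs"
  let ?zs = "map2 gamma ts ?ys"
  assume xs: "length xs = leaves (Node \<phi> ts) \<and> i < leaves (Node \<phi> ts)"
  then obtain k j where kj: "k < length ts" "j < leaves (ts ! k)"
    and upd: "\<And>x. split_list_by ?ns (xs[i := x]) = ?ys[k := (?ys ! k)[j := x]]"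
    using split_list_by_update[of xs ?ns i] by auto
  have "map2 gamma ts (split_list_by ?ns (xs[i := x])) = ?zs[k := gamma (ts ! k) ((?ys ! k)[j := x])]" for x
    unfolding upd using kj by (intro nth_equalityI) (auto simp: nth_list_update)
  then have eq: "(\<lambda>x. gamma (Node \<phi> ts) (xs[i := x])) =
      (\<lambda>y. \<phi> (?zs[k := y])) \<circ> (\<lambda>x. gamma (ts ! k) ((?ys ! k)[j := x]))"
    using xs by (auto simp: fun_eq_iff gamma_Node simp del: gamma.simps)
  show "Vector_Spaces.linear s s (\<lambda>x. gamma (Node \<phi> ts) (xs[i := x]))"
    unfolding eq
  proof (rule Vector_Spaces.linear_compose)
    show "Vector_Spaces.linear s s (\<lambda>x. gamma (ts ! k) ((?ys ! k)[j := x]))"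
      using kj xs by (intro multilinear_linear[OF ts]) (auto simp: length_split_list_by_nth)
    show "Vector_Spaces.linear s s (\<lambda>y. \<phi> (?zs[k := y]))"
      using kj by (intro multilinear_linear[OF \<phi>]) auto
  qed
qed

lemma multilinear_gamma_Leaf:
  assumes "vector_space s"
  shows "multilinear s s (leaves Leaf) (gamma Leaf)"
proof -
  interpret vector_space s by fact
  have "Vector_Spaces.linear s s (\<lambda>x. gamma Leaf (xs[0 := x]))" if "length xs = 1" for xs
    using that linear_ident by (cases xs) auto
  then show ?thesis
    by (auto simp: multilinear_def)
qed

section \<open>Graphs with matching arities\<close>

primrec well_formed :: "gen tree \<Rightarrow> bool" where
  "well_formed Leaf \<longleftrightarrow> True"
| "well_formed (Node e ts) \<longleftrightarrow> e \<in> generators \<and> length ts = arity e \<and> list_all well_formed ts"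

lemma redecorate_Node:
  "redecorate (Node e ts) D =
    Node (D [] e) (map (\<lambda>i. redecorate (ts ! i) (\<lambda>p. D (i # p))) [0..<length ts])"
proof -
  have "map2 (\<lambda>i r. r (\<lambda>p. D (i # p))) [0..<length ts] (map redecorate ts) =
      map (\<lambda>i. redecorate (ts ! i) (\<lambda>p. D (i # p))) [0..<length ts]"
    by (rule nth_equalityI) simp_all
  then show ?thesis
    by simp
qed

declare redecorate.simps(2) [simp del]

lemma leaves_redecorate [simp]: "leaves (redecorate t D) = leaves t"
proof (induction t arbitrary: D)
  case (Node e ts)
  then have "map (\<lambda>i. leaves (redecorate (ts ! i) (\<lambda>p. D (i # p)))) [0..<length ts] = map leaves ts"
    by (intro nth_equalityI) auto
  then show ?case
    by (simp add: redecorate_Node comp_def)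
qed simp

text \<open>A tree does not record how many inputs its decorations expect;
  \<open>well_formed\<close> supplies this match, and then \<open>multilinear_gamma_Node\<close>
  applies at every vertex. The induction generalises \<open>D\<close> because a child sees the
  decoration along shifted paths.\<close>

lemma multilinear_gamma_redecorate:
  assumes vs: "vector_space s"
    and "well_formed t"
    and "\<And>p e. e \<in> generators \<Longrightarrow> multilinear s s (arity e) (D p e)"
  shows "multilinear s s (leaves t) (gamma (redecorate t D))"
  using assms(2,3)
proof (induction t arbitrary: D)
  case Leaf
  then show ?case
    using multilinear_gamma_Leaf[OF vs] by simp
next
  case (Node e ts)
  have "multilinear s s (leaves (redecorate (Node e ts) D)) (gamma (redecorate (Node e ts) D))"
    unfolding redecorate_Node
  proof (rule multilinear_gamma_Node)
    fix t
    assume "t \<in> set (map (\<lambda>i. redecorate (ts ! i) (\<lambda>p. D (i # p))) [0..<length ts])"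
    then obtain i where i: "i < length ts" "t = redecorate (ts ! i) (\<lambda>p. D (i # p))"
      by auto
    have "multilinear s s (leaves (ts ! i)) (gamma (redecorate (ts ! i) (\<lambda>p. D (i # p))))"
      using Node i by (intro Node.IH) (auto simp: list_all_iff)
    then show "multilinear s s (leaves t) (gamma t)"
      using i by simp
  qed (use Node in auto)
  then show ?case
    by (simp only: leaves_redecorate)
qed

lemma well_formed_corolla: "e \<in> generators \<Longrightarrow> well_formed (corolla e)"
  by (simp add: corolla_def list_all_iff)

lemma leaves_corolla [simp]: "leaves (corolla e) = arity e"
  by (simp add: corolla_def sum_list_replicate)

lemma well_formed_graft:
  "e \<in> generators \<Longrightarrow> e' \<in> generators \<Longrightarrow> 1 \<le> s \<Longrightarrow> s \<le> arity e \<Longrightarrow> well_formed (graft e s e')"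
  by (auto simp: graft_def list_all_iff well_formed_corolla)

lemma leaves_graft:
  "1 \<le> s \<Longrightarrow> s \<le> arity e \<Longrightarrow> leaves (graft e s e') = arity e + arity e' - 1"
  by (simp add: graft_def sum_list_replicate)

lemma finite_compositions:
  "finite {r. length r = l \<and> (\<forall>a\<in>set r. 1 \<le> a) \<and> sum_list r = (n::nat)}"
proof (rule finite_subset)
  show "{r. length r = l \<and> (\<forall>a\<in>set r. 1 \<le> a) \<and> sum_list r = n} \<subseteq> {r. set r \<subseteq> {..n} \<and> length r = l}"
    using member_le_sum_list by blast
  show "finite {r. set r \<subseteq> {..n} \<and> length r = l}"
    by (rule finite_lists_length_eq) simp
qed

lemma keys_sum_subset:
  assumes "\<And>a. a \<in> A \<Longrightarrow> Poly_Mapping.keys (f a) \<subseteq> S"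
  shows "Poly_Mapping.keys (\<Sum>a\<in>A. f a) \<subseteq> S"
  using keys_sum[of f A] assms by blast

lemma generators_simps [simp]:
  "Mu n \<in> generators \<longleftrightarrow> 2 \<le> n"
  "Nu n \<in> generators \<longleftrightarrow> 2 \<le> n"
  "Ff n \<in> generators \<longleftrightarrow> 1 \<le> n"
  by (auto simp: generators_def)

text \<open>This makes all summands of \<open>l2 e\<close> multilinear of one common arity, so that
  their sum is again multilinear.\<close>

lemma keys_boundary:
  assumes "e \<in> generators"
  shows "Poly_Mapping.keys (boundary e :: gen tree \<Rightarrow>\<^sub>0 'k::field) \<subseteq>
    {t. well_formed t \<and> leaves t = arity e}" (is "_ \<subseteq> ?S e")
proof -
  have signed: "Poly_Mapping.keys (signed a t :: gen tree \<Rightarrow>\<^sub>0 'k) \<subseteq> S" if "t \<in> S" for a t S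
    using that by simp
  \<comment> \<open>The three families of two-vertex graphs share this shape of sum.\<close>
  have double_sum: "Poly_Mapping.keys (\<Sum>(i, j)\<in>A. \<Sum>s=0..h i j. signed (q i j s) (t i j s) :: gen tree \<Rightarrow>\<^sub>0 'k) \<subseteq> S"
    if "\<And>i j s. (i, j) \<in> A \<Longrightarrow> s \<in> {0..h i j} \<Longrightarrow> t i j s \<in> S" for A h q t S
  proof (rule keys_sum_subset)
    fix a
    assume "a \<in> A"
    then show "Poly_Mapping.keys ((case a of (i, j) \<Rightarrow> \<Sum>s=0..h i j. signed (q i j s) (t i j s)) :: gen tree \<Rightarrow>\<^sub>0 'k) \<subseteq> S"
      by (cases a) (simp only: prod.case, intro keys_sum_subset signed that, auto)
  qed
  show ?thesis
  proof (cases e)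
    case (Mu n)
    have "graft (Mu i) (s + 1) (Mu j) \<in> ?S (Mu n)"
      if "i + j = n + 1 \<and> 2 \<le> i \<and> 2 \<le> j" "s \<in> {0..n - j}" for i j s
      using that by (auto simp: leaves_graft intro!: well_formed_graft)
    then show ?thesis
      unfolding Mu boundary.simps by (intro double_sum) blast
  next
    case (Nu n)
    have "graft (Nu i) (s + 1) (Nu j) \<in> ?S (Nu n)"
      if "i + j = n + 1 \<and> 2 \<le> i \<and> 2 \<le> j" "s \<in> {0..n - j}" for i j s
      using that by (auto simp: leaves_graft intro!: well_formed_graft)
    then show ?thesis
      unfolding Nu boundary.simps by (intro double_sum) blast
  next
    case (Ff n)
    have 1: "graft (Ff i) (s + 1) (Mu j) \<in> ?S (Ff n)"
      if "i + j = n + 1 \<and> 1 \<le> i \<and> 2 \<le> j" "s \<in> {0..n - j}" for i j s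
      using that by (auto simp: leaves_graft intro!: well_formed_graft)
    have 2: "Node (Nu l) (map (\<lambda>a. corolla (Ff a)) r) \<in> ?S (Ff n)"
      if "l \<in> {2..n}" "r \<in> {r. length r = l \<and> (\<forall>a\<in>set r. 1 \<le> a) \<and> sum_list r = n}" for l r
      using that by (auto simp: list_all_iff comp_def intro!: well_formed_corolla)
    show ?thesis
      unfolding Ff boundary.simps
    proof (rule order_trans[OF keys_diff Un_least], goal_cases)
      case 1
      show ?case
        unfolding keys_minus by (intro keys_sum_subset signed 2)
    next
      case 2
      show ?case
        using 1 by (intro double_sum) blast
    qed
  qed
qed


section \<open>Partial compositions and two-vertex graphs\<close>

text \<open>Together with \<open>gamma_wrong_length\<close> this reduces the comparison of
  composites to lists of the right length. A list too short for the inner block gives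
  \<open>\<psi>\<close> an argument of the wrong length, and the resulting entry \<open>0\<close>
  annihilates \<open>\<phi>\<close>.\<close>

lemma circ_wrong_length:
  assumes \<phi>: "multilinear s2 s3 h \<phi>" and \<psi>: "multilinear s1 s2' k \<psi>"
    and "1 \<le> s" "s \<le> h" "1 \<le> k" "length xs \<noteq> h + k - 1"
  shows "circ \<phi> s k \<psi> xs = 0"
proof (cases "s - 1 + k \<le> length xs")
  case True
  then show ?thesis
    unfolding circ_def using assms by (intro multilinear_wrong_length[OF \<phi>]) auto
next
  case False
  then have "\<psi> (take k (drop (s - 1) xs)) = 0"
    using assms by (intro multilinear_wrong_length[OF \<psi>]) auto
  then show ?thesis
    unfolding circ_def by (intro multilinear_zero_entry[OF \<phi>]) simp
qed

lemma circ_zero_left: "circ (\<lambda>_. 0) s k \<psi> = (\<lambda>_. 0)"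
  by (simp add: circ_def fun_eq_iff)

lemma circ_zero_right: "multilinear s1 s2 h \<phi> \<Longrightarrow> circ \<phi> s k (\<lambda>_. 0) = (\<lambda>_. 0)"
  by (auto simp: circ_def fun_eq_iff intro: multilinear_zero_entry)

lemma circ_along_wrong_length:
  assumes \<phi>: "multilinear s2 s3 h \<phi>" and \<psi>: "multilinear s1 s2' k \<psi>"
    and "1 \<le> s" "s \<le> h" "1 \<le> k" "length xs \<noteq> h + k - 1"
  shows "circ_along g \<phi> s k \<psi> xs = 0"
proof (cases "s - 1 + k \<le> length xs")
  case True
  then show ?thesis
    unfolding circ_along_def using assms by (intro multilinear_wrong_length[OF \<phi>]) auto
next
  case False
  then have "\<psi> (take k (drop (s - 1) xs)) = 0"
    using assms by (intro multilinear_wrong_length[OF \<psi>]) auto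
  then show ?thesis
    unfolding circ_along_def by (intro multilinear_zero_entry[OF \<phi>]) simp
qed

lemma cup_wrong_length:
  fixes \<phi> \<psi> :: "'a::ab_group_add list \<Rightarrow> 'b::ring"
  assumes \<phi>: "multilinear s1 s2 a \<phi>" and \<psi>: "multilinear s3 s4 b \<psi>"
    and "length xs \<noteq> a + b"
  shows "cup a \<phi> \<psi> xs = 0"
proof (cases "a \<le> length xs")
  case True
  then have "\<psi> (drop a xs) = 0"
    using assms by (intro multilinear_wrong_length[OF \<psi>]) auto
  then show ?thesis by (simp add: cup_def)
next
  case False
  then have "\<phi> (take a xs) = 0"
    using assms by (intro multilinear_wrong_length[OF \<phi>]) auto
  then show ?thesis by (simp add: cup_def)
qed

section \<open>Partial compositions inside \<open>End_T\<close> and as composites of graphs\<close>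

lemma circ_emb_UU_emb_UU:
  "circ (emb_UU \<phi>) s k (emb_UU \<psi> :: ('u \<times> 'v::zero) endo) = emb_UU (circ \<phi> s k \<psi>)"
  by (simp add: circ_def emb_UU_def fun_eq_iff take_map drop_map)

lemma circ_emb_VV_emb_VV:
  "circ (emb_VV \<phi>) s k (emb_VV \<psi> :: ('u::zero \<times> 'v) endo) = emb_VV (circ \<phi> s k \<psi>)"
  by (simp add: circ_def emb_VV_def fun_eq_iff take_map drop_map)

lemma circ_emb_UV_emb_UU:
  "circ (emb_UV \<phi>) s k (emb_UU \<psi> :: ('u::zero \<times> 'v::zero) endo) = emb_UV (circ \<phi> s k \<psi>)"
  by (simp add: circ_def emb_UU_def emb_UV_def fun_eq_iff take_map drop_map)

lemma map2_split_list_by_ones: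
  "length xs = k \<Longrightarrow>
    map2 f (replicate k t) (split_list_by (replicate k (Suc 0)) xs) = map (\<lambda>x. f t [x]) xs"
proof (induction k arbitrary: xs)
  case (Suc k)
  then show ?case by (cases xs) auto
qed simp

lemma sum_list_replicate_Suc_0 [simp]: "sum_list (replicate k (Suc 0)) = k"
  by (simp add: sum_list_replicate)

lemma gamma_Node_Leaves:
  "length xs = k \<Longrightarrow> gamma (Node b (replicate k Leaf)) xs = b xs"
  by (subst gamma_Node) (simp_all add: map2_split_list_by_ones)

text \<open>Each leaf consumes one input and returns it unchanged, so the leaves beside the inner
  vertex supply the identities of a partial composition.\<close>

lemma gamma_graft:
  assumes "1 \<le> s" "s \<le> h" "length xs = h + k - 1"
  shows "gamma (Node a (replicate (s - 1) Leaf @ Node b (replicate k Leaf) # replicate (h - s) Leaf)) xs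
    = circ a s k b xs"
proof -
  have "length (drop (s - 1) xs) = k + (h - s)"
    using assms by auto
  then show ?thesis
    using assms
    by (subst gamma_Node)
      (auto simp: split_list_by_append map2_split_list_by_ones gamma_Node_Leaves circ_def add.commute
        simp del: gamma.simps(2))
qed

lemma sum_distinct_pairs:
  assumes "finite V"
  shows "(\<Sum>vs | length vs = 2 \<and> distinct vs \<and> set vs \<subseteq> V. h vs) = (\<Sum>v\<in>V. \<Sum>w\<in>V - {v}. h [v, w])"
proof -
  have "{vs. length vs = 2 \<and> distinct vs \<and> set vs \<subseteq> V} = (\<lambda>(v, w). [v, w]) ` (SIGMA v:V. V - {v})"
    by (auto simp: numeral_2_eq_2 length_Suc_conv image_iff)
  moreover have "inj_on (\<lambda>(v, w). [v, w]) (SIGMA v:V. V - {v})"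
    by (auto simp: inj_on_def)
  ultimately show ?thesis
    using assms by (simp add: sum.reindex sum.Sigma case_prod_unfold)
qed

lemma redecorate_corolla: "redecorate (corolla e) D = Node (D [] e) (replicate (arity e) Leaf)"
  by (auto simp: corolla_def redecorate_Node intro!: nth_equalityI)

lemma redecorate_graft:
  assumes "1 \<le> s"
  shows "redecorate (graft e s e') D = Node (D [] e)
    (replicate (s - 1) Leaf @ Node (D [s - 1] e') (replicate (arity e') Leaf) # replicate (arity e - s) Leaf)"
proof -
  \<comment> \<open>The inner vertex is child number \<open>s - 1\<close>, counted from 0; the two
    bounds on \<open>i\<close> pin it to that position.\<close>
  have D: "D [i] e' = D [s - Suc 0] e'" if "Suc i \<le> s" "\<not> i < s - Suc 0" for i
    using that by (intro arg_cong[of _ _ "\<lambda>i. D [i] e'"]) simp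
  show ?thesis
    using assms
    by (auto simp: graft_def redecorate_Node redecorate_corolla nth_append nth_Cons'
        intro!: nth_equalityI D)
qed

lemma vertices_Node: "vertices (Node e ts) = insert [] (\<Union>i<length ts. (#) i ` vertices (ts ! i))"
  by simp

lemma vertices_corolla [simp]: "vertices (corolla e) = {[]}"
  by (simp add: corolla_def)

lemma vertices_graft:
  assumes "1 \<le> s" 
  shows "vertices (graft e s e') = {[], [s - 1]}"
proof -
  define ts where "ts = replicate (s - 1) Leaf @ corolla e' # replicate (arity e - s) Leaf"
  have "vertices (ts ! i) = (if i = s - 1 then {[]} else {})" if "i < length ts" for i
    using that by (auto simp: ts_def nth_append nth_Cons')
  moreover have "s - 1 < length ts"
    by (simp add: ts_def)
  moreover have "graft e s e' = Node e ts"
    by (simp add: graft_def ts_def)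
  ultimately show ?thesis
    by (auto simp: vertices_Node simp del: vertices.simps(2) split: if_splits)
qed

lemma act_End_id [simp]: "act_End \<phi> id = \<phi>"
  by (simp add: act_End_def fun_eq_iff inv_id[unfolded id_def] id_def[symmetric])


section \<open>Decorations by a pair of cochains\<close>

lemma vector_space_scaleT:
  assumes "vector_space sU" "vector_space sV"
  shows "vector_space (scaleT sU sV)"
proof -
  interpret U: vector_space sU by fact
  interpret V: vector_space sV by fact
  show ?thesis
    by unfold_locales
      (auto simp: scaleT_def U.scale_right_distrib V.scale_right_distrib
        U.scale_left_distrib V.scale_left_distrib)
qed

lemma fst_scaleT [simp]: "fst (scaleT sU sV c x) = sU c (fst x)"
  and snd_scaleT [simp]: "snd (scaleT sU sV c x) = sV c (snd x)"
  by (simp_all add: scaleT_def)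

lemma End_T_multilinear:
  "\<phi> \<in> End_T sU sV cs d \<Longrightarrow> multilinear (scaleT sU sV) (scaleT sU sV) (length cs) \<phi>"
  by (simp add: End_T_def)

lemma gen_elt_in_E: "e \<in> generators \<Longrightarrow> gen_elt e \<in> E (inputs e) (out_color e)"
  by (simp add: gen_elt_def E_def permutes_id)

section \<open>Multilinearity and values of \<open>\<beta>\<close>\<close>

context algebra_morphism
begin

abbreviation sT where "sT \<equiv> scaleT sU sV"

sublocale T: vector_space sT
  by (rule vector_space_scaleT) unfold_locales

sublocale TT: vector_space_pair sT sT
  by unfold_locales

lemma multilinear_emb_UU:
  assumes "multilinear sU sU n \<phi>"
  shows "multilinear sT sT n (emb_UU \<phi>)"
proof -
  have "Vector_Spaces.linear sU sU (\<lambda>x. \<phi> ((map fst xs)[i := x]))"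
    if "length xs = n \<and> i < n" for xs :: "('u \<times> 'v) list" and i
    using that by (intro multilinear_linear[OF assms]) auto
  then show ?thesis
    using assms
    by (auto simp: multilinear_def Vector_Spaces.linear_iff emb_UU_def map_update zero_prod_def
        prod_eq_iff T.vector_space_axioms)
qed

lemma multilinear_emb_VV:
  assumes "multilinear sV sV n \<phi>"
  shows "multilinear sT sT n (emb_VV \<phi>)"
proof -
  have "Vector_Spaces.linear sV sV (\<lambda>x. \<phi> ((map snd xs)[i := x]))"
    if "length xs = n \<and> i < n" for xs :: "('u \<times> 'v) list" and i
    using that by (intro multilinear_linear[OF assms]) auto
  then show ?thesis
    using assms
    by (auto simp: multilinear_def Vector_Spaces.linear_iff emb_VV_def map_update zero_prod_def
        prod_eq_iff T.vector_space_axioms)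
qed

lemma multilinear_emb_UV:
  assumes "multilinear sU sV n \<phi>"
  shows "multilinear sT sT n (emb_UV \<phi>)"
proof -
  have "Vector_Spaces.linear sU sV (\<lambda>x. \<phi> ((map fst xs)[i := x]))"
    if "length xs = n \<and> i < n" for xs :: "('u \<times> 'v) list" and i
    using that by (intro multilinear_linear[OF assms]) auto
  then show ?thesis
    using assms
    by (auto simp: multilinear_def Vector_Spaces.linear_iff emb_UV_def map_update zero_prod_def
        prod_eq_iff T.vector_space_axioms)
qed

lemma multilinear_mult:
  assumes "assoc_algebra s"
  shows "multilinear s s 2 (\<lambda>xs. if length xs = 2 then xs ! 0 * xs ! 1 else 0)"
proof -
  interpret assoc_algebra s by fact
  have "Vector_Spaces.linear s s (\<lambda>x. x * b)" "Vector_Spaces.linear s s (\<lambda>x. b * x)" for b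
    by (simp_all add: Vector_Spaces.linear_iff vector_space_axioms scale_mult_left scale_mult_right algebra_simps)
  then have "Vector_Spaces.linear s s (\<lambda>x. xs[i := x] ! 0 * xs[i := x] ! 1)"
    if "length xs = 2" "i < 2" for xs i
    using that by (cases "i = 0") (auto simp: less_2_cases_iff)
  then show ?thesis
    by (auto simp: multilinear_def)
qed

lemma multilinear_beta_gen: "multilinear sT sT (arity e) (beta_gen g e)"
proof (cases e)
  case (Mu n)
  then show ?thesis
    using multilinear_emb_UU[OF multilinear_mult[OF U.assoc_algebra_axioms]]
    by (auto intro: TT.multilinear_zero)
next
  case (Nu n)
  then show ?thesis
    using multilinear_emb_VV[OF multilinear_mult[OF V.assoc_algebra_axioms]]
    by (auto intro: TT.multilinear_zero)
next
  case (Ff n)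
  have "multilinear sU sV 1 (\<lambda>xs. if length xs = 1 then g (xs ! 0) else 0)"
    by (auto simp: multilinear_def Vector_Spaces.linear_iff add scale U.vector_space_axioms V.vector_space_axioms)
  from multilinear_emb_UV[OF this] Ff show ?thesis
    by (auto intro: TT.multilinear_zero)
qed

lemma extend_gen_elt: "extend sT a (gen_elt e) = a e"
  by (simp add: fun_eq_iff extend_eq_lin_ext gen_elt_def)

lemma beta_gen_elt: "beta sU sV g (gen_elt e) = beta_gen g e"
  by (simp add: beta_def extend_gen_elt)

end

text \<open>A cochain of degree \<open>n - 1\<close> lives on generators of degree
  \<open>n - 2\<close>, which are \<open>Mu n\<close>, \<open>Nu n\<close> and
  \<open>Ff (n - 1)\<close>. This is the source of the shift by one in all components on
  \<open>Ff\<close>.\<close>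

locale cochain_pair = algebra_morphism sU sV g
  for sU :: "'k::field \<Rightarrow> 'u::ring \<Rightarrow> 'u" and sV :: "'k \<Rightarrow> 'v::ring \<Rightarrow> 'v" and g +
  fixes n m :: nat and \<theta> \<omega> :: "('k, 'u, 'v) cochain"
  assumes n: "2 \<le> n" and m: "2 \<le> m"
    and \<theta>: "\<theta> \<in> def_complex sU sV (n - 1)"
    and \<omega>: "\<omega> \<in> def_complex sU sV (m - 1)"
  fixes \<theta>U \<theta>V \<theta>g \<omega>U \<omega>V \<omega>g
  assumes \<theta>_GS: "(\<theta>U, \<theta>V, \<theta>g) \<in> C_GS sU sV n" and \<theta>_corr: "corresponds n \<theta> (\<theta>U, \<theta>V, \<theta>g)"
    and \<omega>_GS: "(\<omega>U, \<omega>V, \<omega>g) \<in> C_GS sU sV m" and \<omega>_corr: "corresponds m \<omega> (\<omega>U, \<omega>V, \<omega>g)"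
begin

abbreviation "\<theta>e \<equiv> \<lambda>e. \<theta> (gen_elt e)"
abbreviation "\<omega>e \<equiv> \<lambda>e. \<omega> (gen_elt e)"

lemma multilinear_cochain:
  assumes "\<xi> \<in> def_complex sU sV p" "e \<in> generators"
  shows "multilinear sT sT (arity e) (\<xi> (gen_elt e))"
  using assms gen_elt_in_E[OF assms(2)]
  by (intro End_T_multilinear) (auto simp: def_complex_def)

lemmas multilinear_\<theta> = multilinear_cochain[OF \<theta>]
  and multilinear_\<omega> = multilinear_cochain[OF \<omega>]

lemma cochain_zero:
  "\<xi> \<in> def_complex sU sV p \<Longrightarrow> e \<in> generators \<Longrightarrow> degree e + 1 \<noteq> p \<Longrightarrow> \<xi> (gen_elt e) = (\<lambda>_. 0)"
  by (simp add: def_complex_def)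

definition decoration :: "nat list \<Rightarrow> nat list \<Rightarrow> nat list \<Rightarrow> gen \<Rightarrow> ('u \<times> 'v) endo"
  where "decoration v w u e = (if u = v then \<theta>e e else if u = w then \<omega>e e else beta_gen g e)"

lemma multilinear_decoration:
  "e \<in> generators \<Longrightarrow> multilinear sT sT (arity e) (decoration v w u e)"
  by (simp add: decoration_def multilinear_\<theta> multilinear_\<omega> multilinear_beta_gen)

text \<open>The contribution of one graph to \<open>l_gen\<close> for two cochains, isolated as a
  function on graphs so that it can be extended linearly over \<open>boundary\<close>.\<close>

definition pair_value :: "gen tree \<Rightarrow> ('u \<times> 'v) endo"
  where "pair_value \<Gamma> ts =
    (\<Sum>v\<in>vertices \<Gamma>. \<Sum>w\<in>vertices \<Gamma> - {v}. gamma (redecorate \<Gamma> (decoration v w)) ts)"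

lemma finite_vertices: "finite (vertices \<Gamma>)"
  by (induction \<Gamma>) (auto intro!: finite_imageI)

definition l2 :: "gen \<Rightarrow> ('u \<times> 'v) endo"
  where "l2 = l_gen sU sV g [(n - 1, \<theta>), (m - 1, \<omega>)]"

text \<open>For two arguments the exponent \<open>nu_exponent\<close> reduces to the degree of the
  first one, here \<open>n - 1\<close>. The rest is the defining sum of \<open>l_gen\<close>, read
  as a linear extension.\<close>

lemma l2_eq:
  "l2 \<xi> ts = sT ((-1) ^ (n - 1)) (lin_ext sT (\<lambda>\<Gamma>. pair_value \<Gamma> ts) (boundary \<xi>))"
proof -
  have "substitute sU sV g [(n - 1, \<theta>), (m - 1, \<omega>)] [v, w] \<Gamma> = redecorate \<Gamma> (decoration v w)" for v w \<Gamma>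
    unfolding substitute_def
    by (rule arg_cong[of _ _ "redecorate \<Gamma>"]) (auto simp: fun_eq_iff decoration_def beta_gen_elt)
  moreover have "nu_exponent [(n - 1, \<theta>), (m - 1, \<omega>)] = n - 1"
    by (simp add: nu_exponent_def numeral_2_eq_2)
  moreover have "length [(n - 1, \<theta>), (m - 1, \<omega>)] = 2"
    by simp
  ultimately show ?thesis
    by (simp only: l2_def l_gen_def lin_ext_def pair_value_def sum_distinct_pairs[OF finite_vertices])
qed

lemma multilinear_l2:
  assumes "e \<in> generators"
  shows "multilinear sT sT (arity e) (l2 e)"
proof -
  have "multilinear sT sT (arity e) (pair_value \<Gamma>)" if "well_formed \<Gamma>" "leaves \<Gamma> = arity e" for \<Gamma>
    unfolding pair_value_def[abs_def] that(2)[symmetric]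
    by (intro TT.multilinear_sum multilinear_gamma_redecorate T.vector_space_axioms that
        multilinear_decoration)
  then show ?thesis
    using keys_boundary[OF assms, where 'k = 'k]
    unfolding l2_eq[abs_def] lin_ext_def
    by (intro TT.multilinear_sum TT.multilinear_scale) auto
qed

text \<open>There are just two vertices, hence two ordered pairs, and no vertex is left to carry
  \<open>\<beta>\<close>.\<close>

lemma pair_value_graft:
  assumes e: "e \<in> generators" "e' \<in> generators" and s: "1 \<le> s" "s \<le> arity e"
  shows "pair_value (graft e s e') ts =
    circ (\<theta>e e) s (arity e') (\<omega>e e') ts + circ (\<omega>e e) s (arity e') (\<theta>e e') ts"
proof -
  let ?N = "\<lambda>D. gamma (redecorate (graft e s e') D) ts"
  have "1 \<le> arity e'"
    using e by (auto simp: generators_def)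
  moreover have "leaves (graft e s e') = arity e + arity e' - 1"
    using s by (rule leaves_graft)
  ultimately have *: "?N (decoration v w) = circ (decoration v w [] e) s (arity e') (decoration v w [s - 1] e') ts" for v w
  proof (cases "length ts = arity e + arity e' - 1")
    case True
    then show ?thesis
      using s by (simp only: redecorate_graft gamma_graft)
  next
    case False
    then have "?N (decoration v w) = 0"
      using s by (intro gamma_wrong_length) (simp add: leaves_graft)
    then show ?thesis
      using s False \<open>1 \<le> arity e'\<close>
        circ_wrong_length[OF multilinear_decoration[OF e(1)] multilinear_decoration[OF e(2)]]
      by simp
  qed
  have "pair_value (graft e s e') ts = ?N (decoration [] [s - 1]) + ?N (decoration [s - 1] [])"
    using s by (simp add: pair_value_def vertices_graft insert_Diff_if del: One_nat_def)
  then show ?thesis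
    unfolding * by (simp add: decoration_def)
qed

text \<open>\<open>F\<close> is supported at arity \<open>a\<close> and \<open>G\<close> at arity
  \<open>b\<close>, so only the pair \<open>(a, b)\<close> can survive, and it is a summand exactly
  if \<open>a + b = N + 1\<close>. The bound \<open>c\<close> is 2 for the families
  \<open>Mu\<close> and \<open>Nu\<close> and 1 for \<open>Ff\<close>.\<close>

lemma graft_sum_half:
  fixes P Q :: "nat \<Rightarrow> gen" and F G :: "gen \<Rightarrow> ('u \<times> 'v) endo"
  assumes F: "\<And>i. c \<le> i \<Longrightarrow> i \<noteq> a \<Longrightarrow> F (P i) = (\<lambda>_. 0)" "\<And>i. c \<le> i \<Longrightarrow> multilinear sT sT i (F (P i))"
    and G: "\<And>j. 2 \<le> j \<Longrightarrow> j \<noteq> b \<Longrightarrow> G (Q j) = (\<lambda>_. 0)"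
    and ab: "1 \<le> c" "c \<le> a" "2 \<le> b"
  shows "(\<Sum>(i, j)\<in>{(i, j). i + j = N + 1 \<and> c \<le> i \<and> 2 \<le> j}. \<Sum>s=0..N - j.
      sT ((-1) ^ (i + s * (j + 1))) (circ (F (P i)) (s + 1) j (G (Q j)) ts)) =
    (if a + b = N + 1
     then sT ((-1) ^ a) (\<Sum>s=1..a. sT ((-1) ^ ((s + 1) * (b + 1))) (circ (F (P a)) s b (G (Q b)) ts))
     else 0)" (is "sum ?f ?S = _")
proof -
  have "finite ?S"
    by (rule finite_subset[of _ "{..N + 1} \<times> {..N + 1}"]) auto
  moreover have "?f x = 0" if "x \<in> ?S" "x \<noteq> (a, b)" for x
  proof -
    obtain i j where x: "x = (i, j)" by (cases x)
    have "i \<noteq> a \<or> j \<noteq> b"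
      using that x by auto
    then have "circ (F (P i)) s j (G (Q j)) = (\<lambda>_. 0)" for s
      using that F G x by (auto simp: circ_zero_left simp: circ_zero_right[OF F(2)])
    then show ?thesis by (simp add: x)
  qed
  ultimately have "sum ?f ?S = (if (a, b) \<in> ?S then ?f (a, b) else 0)"
    by (rule sum_single_support)
  also have "\<dots> = (if a + b = N + 1 then ?f (a, b) else 0)"
    using ab by simp
  also have "?f (a, b) = sT ((-1) ^ a) (\<Sum>s=1..a. sT ((-1) ^ ((s + 1) * (b + 1))) (circ (F (P a)) s b (G (Q b)) ts))"
    if "a + b = N + 1"
  proof -
    \<comment> \<open>The shift in \<open>s\<close> runs over all \<open>a\<close> inputs of the
      outer map. Counting them from 1 turns the exponent into \<open>a + (s - 1) * (b + 1)\<close>,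
      and \<open>s - 1\<close> has the parity of \<open>s + 1\<close>.\<close>
    have "a - 1 = N - b" "1 \<le> a" using that ab by auto
    then have "?f (a, b) = (\<Sum>s\<in>{0..a - 1}. sT ((-1) ^ (a + s * (b + 1))) (circ (F (P a)) (s + 1) b (G (Q b)) ts))"
      by simp
    also have "\<dots> = (\<Sum>s\<in>{1..a}. sT ((-1) ^ (a + (s - 1) * (b + 1))) (circ (F (P a)) s b (G (Q b)) ts))"
      by (rule sum.reindex_bij_witness[of _ "\<lambda>s. s - 1" "\<lambda>s. s + 1"]) (use \<open>1 \<le> a\<close> in auto)
    also have "\<dots> = (\<Sum>s\<in>{1..a}. sT ((-1) ^ a) (sT ((-1) ^ ((s + 1) * (b + 1))) (circ (F (P a)) s b (G (Q b)) ts)))"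
    proof (rule sum.cong[OF refl])
      fix s
      assume "s \<in> {1..a}"
      then show "sT ((-1) ^ (a + (s - 1) * (b + 1))) (circ (F (P a)) s b (G (Q b)) ts) =
        sT ((-1) ^ a) (sT ((-1) ^ ((s + 1) * (b + 1))) (circ (F (P a)) s b (G (Q b)) ts))"
        unfolding T.scale_scale power_add[symmetric]
        by (intro T.scale_minus_one_power_cong) auto
    qed
    finally show ?thesis
      by (simp only: T.scale_sum_right)
  qed
  ultimately show ?thesis by simp
qed

text \<open>The two ways of placing \<open>\<theta>\<close> and \<open>\<omega>\<close> are summed
  separately. Each sum collapses to its own pair of arities: \<open>(a, m)\<close> with
  \<open>\<theta>\<close> outside, \<open>(b, n)\<close> with \<open>\<omega>\<close>
  outside.\<close>

lemma pair_value_graft_sum: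
  fixes P Q :: "nat \<Rightarrow> gen"
  assumes P: "\<And>i. c \<le> i \<Longrightarrow> P i \<in> generators \<and> arity (P i) = i"
    and Q: "\<And>j. 2 \<le> j \<Longrightarrow> Q j \<in> generators \<and> arity (Q j) = j \<and> degree (Q j) = j - 2"
    and \<theta>P: "\<And>i. c \<le> i \<Longrightarrow> i \<noteq> a \<Longrightarrow> \<theta>e (P i) = (\<lambda>_. 0)"
    and \<omega>P: "\<And>i. c \<le> i \<Longrightarrow> i \<noteq> b \<Longrightarrow> \<omega>e (P i) = (\<lambda>_. 0)"
    and c: "1 \<le> c" "c \<le> a" "c \<le> b"
  shows "(\<Sum>(i, j)\<in>{(i, j). i + j = N + 1 \<and> c \<le> i \<and> 2 \<le> j}. \<Sum>s=0..N - j.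
      sT ((-1) ^ (i + s * (j + 1))) (pair_value (graft (P i) (s + 1) (Q j)) ts)) =
    (if a + m = N + 1
     then sT ((-1) ^ a) (\<Sum>s=1..a. sT ((-1) ^ ((s + 1) * (m + 1))) (circ (\<theta>e (P a)) s m (\<omega>e (Q m)) ts))
     else 0) +
    (if b + n = N + 1
     then sT ((-1) ^ b) (\<Sum>s=1..b. sT ((-1) ^ ((s + 1) * (n + 1))) (circ (\<omega>e (P b)) s n (\<theta>e (Q n)) ts))
     else 0)" (is "sum ?f ?S = _")
proof -
  have "sum ?f ?S =
    (\<Sum>(i, j)\<in>?S. \<Sum>s=0..N - j. sT ((-1) ^ (i + s * (j + 1))) (circ (\<theta>e (P i)) (s + 1) j (\<omega>e (Q j)) ts)) +
    (\<Sum>(i, j)\<in>?S. \<Sum>s=0..N - j. sT ((-1) ^ (i + s * (j + 1))) (circ (\<omega>e (P i)) (s + 1) j (\<theta>e (Q j)) ts))"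
    unfolding sum.distrib[symmetric]
  proof (rule sum.cong[OF refl], clarsimp simp: sum.distrib[symmetric], rule sum.cong[OF refl], goal_cases)
    case (1 i j s)
    then show ?case
      using P[of i] Q[of j] c(1)
      by (subst pair_value_graft) (auto simp: T.scale_right_distrib)
  qed
  also have "\<dots> = (if a + m = N + 1
     then sT ((-1) ^ a) (\<Sum>s=1..a. sT ((-1) ^ ((s + 1) * (m + 1))) (circ (\<theta>e (P a)) s m (\<omega>e (Q m)) ts))
     else 0) +
    (if b + n = N + 1
     then sT ((-1) ^ b) (\<Sum>s=1..b. sT ((-1) ^ ((s + 1) * (n + 1))) (circ (\<omega>e (P b)) s n (\<theta>e (Q n)) ts))
     else 0)"
  proof (intro arg_cong2[of _ _ _ _ "(+)"] graft_sum_half)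
    show "multilinear sT sT i (\<theta>e (P i))" "multilinear sT sT i (\<omega>e (P i))" if "c \<le> i" for i
      using multilinear_\<theta>[of "P i"] multilinear_\<omega>[of "P i"] P[OF that] by auto
    show "\<omega>e (Q j) = (\<lambda>_. 0)" if "2 \<le> j" "j \<noteq> m" for j
      using that m Q[of j] by (intro cochain_zero[OF \<omega>]) auto
    show "\<theta>e (Q j) = (\<lambda>_. 0)" if "2 \<le> j" "j \<noteq> n" for j
      using that n Q[of j] by (intro cochain_zero[OF \<theta>]) auto
  qed (use c n m \<theta>P \<omega>P in auto)
  finally show ?thesis .
qed

lemma lin_ext_signed_sum:
  "lin_ext sT f (\<Sum>(i, j)\<in>A. \<Sum>s=0..h i j. signed (q i j s) (t i j s)) =
    (\<Sum>(i, j)\<in>A. \<Sum>s=0..h i j. sT ((-1) ^ q i j s) (f (t i j s)))"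
  by (simp add: T.lin_ext_sum case_prod_unfold)

text \<open>The differentials of \<open>Mu N\<close> and \<open>Nu N\<close> have the same form, so
  one argument serves both. The prefactor \<open>(-1) ^ (n - 1)\<close> meets the outer arity signs
  \<open>(-1) ^ n\<close> and \<open>(-1) ^ m\<close>, leaving \<open>-1\<close> and
  \<open>-(-1) ^ (n + m)\<close>.\<close>

lemma l2_Mu_or_Nu:
  assumes "P = Mu \<or> P = Nu"
  shows "l2 (P N) ts = (if N = n + m - 1 then
      - (\<Sum>s=1..n. sT ((-1) ^ ((s + 1) * (m + 1))) (circ (\<theta>e (P n)) s m (\<omega>e (P m)) ts))
      - sT ((-1) ^ (n + m)) (\<Sum>s=1..m. sT ((-1) ^ ((s + 1) * (n + 1))) (circ (\<omega>e (P m)) s n (\<theta>e (P n)) ts))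
    else 0)"
proof -
  define X where "X = (\<Sum>s=1..n. sT ((-1) ^ ((s + 1) * (m + 1))) (circ (\<theta>e (P n)) s m (\<omega>e (P m)) ts))"
  define Y where "Y = (\<Sum>s=1..m. sT ((-1) ^ ((s + 1) * (n + 1))) (circ (\<omega>e (P m)) s n (\<theta>e (P n)) ts))"
  have P: "P i \<in> generators" "arity (P i) = i" "degree (P i) = i - 2" if "2 \<le> i" for i
    using assms that by auto
  have "boundary (P N) = (\<Sum>(i, j)\<in>{(i, j). i + j = N + 1 \<and> 2 \<le> i \<and> 2 \<le> j}. \<Sum>s=0..N - j.
     signed (i + s * (j + 1)) (graft (P i) (s + 1) (P j)) :: gen tree \<Rightarrow>\<^sub>0 'k)"
    using assms by (elim disjE) (simp_all only: boundary.simps)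
  then have "lin_ext sT (\<lambda>\<Gamma>. pair_value \<Gamma> ts) (boundary (P N)) =
    (if n + m = N + 1 then sT ((-1) ^ n) X else 0) + (if m + n = N + 1 then sT ((-1) ^ m) Y else 0)"
    unfolding X_def Y_def
    by (simp only: lin_ext_signed_sum, intro pair_value_graft_sum)
      (use P n m in \<open>auto intro!: cochain_zero[OF \<theta>] cochain_zero[OF \<omega>]\<close>)
  moreover have "sT ((-1) ^ (n - 1)) (sT ((-1) ^ n) x) = - x" for x
    unfolding T.scale_scale power_add[symmetric]
    using T.scale_minus_one_power_neg[of "n - 1 + n" 0] n by simp
  moreover have "sT ((-1) ^ (n - 1)) (sT ((-1) ^ m) x) = - sT ((-1) ^ (n + m)) x" for x
    unfolding T.scale_scale power_add[symmetric]
    using n by (intro T.scale_minus_one_power_neg) auto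
  moreover have "n + m = N + 1 \<longleftrightarrow> N = n + m - 1"
    using n by auto
  ultimately show ?thesis
    unfolding l2_eq X_def[symmetric] Y_def[symmetric]
    by (simp only: add.commute[of m n] if_distrib[of "sT ((-1) ^ (n - 1))"] T.scale_right_distrib
        T.scale_zero_right) simp
qed

end


section \<open>Graphs with root \<open>\<nu>\<^sub>l\<close>\<close>

lemma split_list_by_ones:
  "length xs = k \<Longrightarrow> split_list_by (replicate k (Suc 0)) xs = map (\<lambda>x. [x]) xs"
proof (induction k arbitrary: xs)
  case (Suc k)
  then show ?case by (cases xs) auto
qed simp

abbreviation nu_tree :: "nat list \<Rightarrow> gen tree"
  where "nu_tree r \<equiv> Node (Nu (length r)) (map (\<lambda>a. corolla (Ff a)) r)"

lemma redecorate_nu_tree: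
  "redecorate (nu_tree r) D = Node (D [] (Nu (length r)))
    (map (\<lambda>i. Node (D [i] (Ff (r ! i))) (replicate (r ! i) Leaf)) [0..<length r])"
  by (auto simp: redecorate_Node redecorate_corolla)

lemma vertices_nu_tree: "vertices (nu_tree r) = insert [] ((\<lambda>i. [i]) ` {..<length r})"
  by (auto simp: vertices_Node simp del: vertices.simps(2))

lemma leaves_nu_tree: "leaves (nu_tree r) = sum_list r"
  by (simp add: comp_def)

lemma gamma_nu_tree:
  assumes "length ts = sum_list r"
  shows "gamma (redecorate (nu_tree r) D) ts = D [] (Nu (length r))
    (map (\<lambda>i. D [i] (Ff (r ! i)) (split_list_by r ts ! i)) [0..<length r])"
proof -
  let ?cs = "map (\<lambda>i. Node (D [i] (Ff (r ! i))) (replicate (r ! i) Leaf)) [0..<length r]"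
  have leaves: "map leaves ?cs = r"
    by (rule nth_equalityI) (simp_all add: sum_list_replicate)
  have "map (\<lambda>i. gamma (?cs ! i) (split_list_by r ts ! i)) [0..<length ?cs] =
      map (\<lambda>i. D [i] (Ff (r ! i)) (split_list_by r ts ! i)) [0..<length r]"
    using assms
    by (intro nth_equalityI)
      (simp_all add: gamma_Node_Leaves length_split_list_by_nth del: gamma.simps)
  then show ?thesis
    using gamma_Node_nth[of ts ?cs "D [] (Nu (length r))"] assms
    by (simp only: leaves redecorate_nu_tree)
qed

text \<open>A vanishing child makes one argument of the root zero, and multilinearity of the root
  does the rest. This is how most compositions are discarded.\<close>

lemma gamma_nu_tree_zero:
  assumes "multilinear s s (length r) (D [] (Nu (length r)))"
    and "D [] (Nu (length r)) = (\<lambda>_. 0) \<or> (\<exists>i<length r. D [i] (Ff (r ! i)) = (\<lambda>_. 0))"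
  shows "gamma (redecorate (nu_tree r) D) ts = 0"
proof (cases "length ts = sum_list r")
  case True
  show ?thesis
    unfolding gamma_nu_tree[OF True] using assms(2)
  proof
    assume "\<exists>i<length r. D [i] (Ff (r ! i)) = (\<lambda>_. 0)"
    then obtain i where "i < length r" "D [i] (Ff (r ! i)) = (\<lambda>_. 0)"
      by blast
    then have "0 \<in> set (map (\<lambda>i. D [i] (Ff (r ! i)) (split_list_by r ts ! i)) [0..<length r])"
      by (auto simp: image_iff intro!: bexI[of _ i])
    then show "D [] (Nu (length r))
      (map (\<lambda>i. D [i] (Ff (r ! i)) (split_list_by r ts ! i)) [0..<length r]) = 0"
      by (rule multilinear_zero_entry[OF assms(1)])
  qed simp
next
  case False
  then show ?thesis
    by (intro gamma_wrong_length) (simp only: leaves_redecorate leaves_nu_tree not_False_eq_True)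
qed

definition sign_exponent :: "nat \<Rightarrow> nat list \<Rightarrow> nat"
  where "sign_exponent l r = (\<Sum>(i, j)\<in>{(i, j). i < j \<and> j < l}. r ! i * (r ! j + 1))"

text \<open>A pair of positions \<open>a < b\<close> contributes \<open>r\<^sub>a (r\<^sub>b + 1)\<close>, which is even unless \<open>b = i\<close>.\<close>

lemma even_sign_exponent:
  assumes "i < p"
  shows "even (sign_exponent p ((replicate p 1)[i := q]) + i * (q + 1))"
proof -
  let ?r = "(replicate p 1)[i := q]"
  let ?f = "\<lambda>a b. ?r ! a * (?r ! b + 1)"
  have "sign_exponent p ?r = (\<Sum>(b, a)\<in>(SIGMA b:{..<p}. {..<b}). ?f a b)"
    unfolding sign_exponent_def
    by (rule sum.reindex_bij_witness[of _ prod.swap prod.swap]) auto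
  also have "\<dots> = (\<Sum>b<p. \<Sum>a<b. ?f a b)"
    by (simp add: sum.Sigma)
  also have "\<dots> = (\<Sum>a<i. ?f a i) + (\<Sum>b\<in>{..<p} - {i}. \<Sum>a<b. ?f a b)"
    using assms by (subst sum.remove[of _ i]) auto
  also have "(\<Sum>a<i. ?f a i) = i * (q + 1)"
    using assms by simp
  finally have "sign_exponent p ?r + i * (q + 1) =
      2 * (i * (q + 1)) + (\<Sum>b\<in>{..<p} - {i}. \<Sum>a<b. ?f a b)"
    by simp
  moreover have "even (\<Sum>b\<in>{..<p} - {i}. \<Sum>a<b. ?f a b)"
    using assms by (intro dvd_sum) auto
  ultimately show ?thesis
    by (simp only: dvd_add dvd_triv_left)
qed

lemma sign_exponent_pair: "sign_exponent 2 [a, b] = a * (b + 1)"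
proof -
  have "{(i::nat, j). i < j \<and> j < 2} = {(0, 1)}"
    by auto
  then show ?thesis
    by (simp add: sign_exponent_def)
qed

abbreviation compositions :: "nat \<Rightarrow> nat \<Rightarrow> nat list set"
  where "compositions l N \<equiv> {r. length r = l \<and> (\<forall>a\<in>set r. 1 \<le> a) \<and> sum_list r = N}"

text \<open>The parts \<open>1, ..., q, ..., 1\<close> add up to \<open>p - 1 + q\<close>, which
  singles out the \<open>N\<close> for which mixed terms occur.\<close>

lemma update_ones_in_compositions_iff:
  assumes "i < p" "1 \<le> q"
  shows "(replicate p 1)[i := q] \<in> compositions p N \<longleftrightarrow> N = p + q - 1"
proof -
  have "1 \<le> a" if "a \<in> set ((replicate p 1)[i := q])" for a
    using set_update_subset_insert[of "replicate p 1" i q] that assms by auto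
  then show ?thesis
    using assms by (auto simp: sum_list_update)
qed

section \<open>Two cochains inserted into a graph with root \<open>Nu l\<close>\<close>

context cochain_pair
begin

text \<open>Abstract \<open>F\<close> and \<open>G\<close> allow both assignments of
  \<open>\<theta>\<close> and \<open>\<omega>\<close> to root and child to be treated at
  once.\<close>

definition root_decoration ::
  "(gen \<Rightarrow> ('u \<times> 'v) endo) \<Rightarrow> (gen \<Rightarrow> ('u \<times> 'v) endo) \<Rightarrow> nat \<Rightarrow> nat list \<Rightarrow> gen \<Rightarrow> ('u \<times> 'v) endo"
  where "root_decoration F G i u e = (if u = [] then F e else if u = [i] then G e else beta_gen g e)"

lemma decoration_root:
  "decoration [] [i] = root_decoration \<theta>e \<omega>e i" "decoration [i] [] = root_decoration \<omega>e \<theta>e i"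
  by (auto simp: fun_eq_iff decoration_def root_decoration_def)

text \<open>The ordered pairs of distinct vertices are sorted by whether the first vertex, the
  second or neither is the root.\<close>

lemma pair_value_nu_tree:
  fixes ts r
  defines "N \<equiv> \<lambda>D. gamma (redecorate (nu_tree r) D) ts"
  shows "pair_value (nu_tree r) ts =
    (\<Sum>i<length r. N (root_decoration \<theta>e \<omega>e i)) + (\<Sum>i<length r. N (root_decoration \<omega>e \<theta>e i)) +
    (\<Sum>i<length r. \<Sum>j\<in>{..<length r} - {i}. N (decoration [i] [j]))"
proof -
  let ?L = "{..<length r}"
  let ?I = "(\<lambda>i. [i]) ` ?L"
  have inj: "inj_on (\<lambda>i. [i]) A" for A :: "nat set"
    by (simp add: inj_on_def)
  have diff: "insert [] ?I - {[]} = ?I" "insert [] ?I - {[i]} = insert [] ((\<lambda>i. [i]) ` (?L - {i}))" for i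
    by auto
  have "pair_value (nu_tree r) ts = (\<Sum>v\<in>insert [] ?I. \<Sum>w\<in>insert [] ?I - {v}. N (decoration v w))"
    by (simp only: pair_value_def N_def vertices_nu_tree)
  also have "\<dots> = (\<Sum>w\<in>?I. N (decoration [] w)) + (\<Sum>v\<in>?I. \<Sum>w\<in>insert [] ?I - {v}. N (decoration v w))"
    by (subst sum.insert) (auto simp: diff)
  also have "\<dots> = (\<Sum>i\<in>?L. N (decoration [] [i])) +
      (\<Sum>i\<in>?L. \<Sum>w\<in>insert [] ((\<lambda>i. [i]) ` (?L - {i})). N (decoration [i] w))"
    by (simp only: sum.reindex[OF inj] comp_def diff)
  also have "(\<Sum>i\<in>?L. \<Sum>w\<in>insert [] ((\<lambda>i. [i]) ` (?L - {i})). N (decoration [i] w)) =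
      (\<Sum>i\<in>?L. N (decoration [i] []) + (\<Sum>j\<in>?L - {i}. N (decoration [i] [j])))"
    by (rule sum.cong[OF refl], subst sum.insert) (auto simp: sum.reindex[OF inj])
  finally show ?thesis
    by (simp only: sum.distrib decoration_root add.assoc)
qed

text \<open>\<open>F\<close> forces the root to have arity \<open>p\<close>, \<open>G\<close> forces
  part \<open>i\<close> to be \<open>q\<close>, and \<open>\<beta>\<close> on the other children
  forces the remaining parts to be 1.\<close>

lemma root_sum:
  assumes F: "\<And>k. 2 \<le> k \<Longrightarrow> k \<noteq> p \<Longrightarrow> F (Nu k) = (\<lambda>_. 0)" "\<And>k. 2 \<le> k \<Longrightarrow> multilinear sT sT k (F (Nu k))"
    and G: "\<And>k. 1 \<le> k \<Longrightarrow> k \<noteq> q \<Longrightarrow> G (Ff k) = (\<lambda>_. 0)"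
    and p: "2 \<le> p" and q: "1 \<le> q"
  shows "(\<Sum>l=2..N. \<Sum>r\<in>compositions l N. sT ((-1) ^ sign_exponent l r)
      (\<Sum>i<length r. gamma (redecorate (nu_tree r) (root_decoration F G i)) ts)) =
    (if N = p + q - 1
     then \<Sum>i<p. sT ((-1) ^ (i * (q + 1)))
       (gamma (redecorate (nu_tree ((replicate p 1)[i := q])) (root_decoration F G i)) ts)
     else 0)"
proof -
  define t where "t r i = gamma (redecorate (nu_tree r) (root_decoration F G i)) ts" for r i
  have t_zero: "t r i = 0"
    if r: "2 \<le> length r" "\<forall>a\<in>set r. 1 \<le> a" "i < length r" "length r \<noteq> p \<or> r \<noteq> (replicate p 1)[i := q]" for r i
  proof -
    have "F (Nu (length r)) = (\<lambda>_. 0) \<or> (\<exists>k<length r. root_decoration F G i [k] (Ff (r ! k)) = (\<lambda>_. 0))"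
    proof (cases "length r = p")
      case True
      \<comment> \<open>A composition of the right length but with other parts differs at some
        \<open>k\<close>. For \<open>k = i\<close> the part is not \<open>q\<close> and
        \<open>G\<close> vanishes; for \<open>k \<noteq> i\<close> the part is not 1 and
        \<open>\<beta>\<close> vanishes.\<close>
      then obtain k where k: "k < p" "r ! k \<noteq> (replicate p 1)[i := q] ! k"
        using r(4) by (auto simp: list_eq_iff_nth_eq)
      moreover have "1 \<le> r ! k"
        using k True r(2) by auto
      ultimately have "root_decoration F G i [k] (Ff (r ! k)) = (\<lambda>_. 0)"
        using True r(3) by (cases "k = i") (auto simp: root_decoration_def G)
      then show ?thesis
        using k True by auto
    next
      case False
      then show ?thesis
        using F(1) r(1) by simp
    qed
    then show ?thesis
      unfolding t_def using F(2)[OF r(1)]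
      by (intro gamma_nu_tree_zero[where s = sT]) (auto simp: root_decoration_def)
  qed
  have "(\<Sum>l=2..N. \<Sum>r\<in>compositions l N. sT ((-1) ^ sign_exponent l r) (\<Sum>i<length r. t r i)) =
    (if p \<in> {2..N} then \<Sum>r\<in>compositions p N. sT ((-1) ^ sign_exponent p r) (\<Sum>i<length r. t r i) else 0)"
    by (intro sum_single_support) (auto simp: t_zero intro!: sum.neutral)
  also have "(\<Sum>r\<in>compositions p N. sT ((-1) ^ sign_exponent p r) (\<Sum>i<length r. t r i)) =
    (\<Sum>r\<in>compositions p N. \<Sum>i<p. sT ((-1) ^ sign_exponent p r) (t r i))"
    by (intro sum.cong) (auto simp: T.scale_sum_right)
  \<comment> \<open>For fixed \<open>i\<close> at most one composition survives. When
    \<open>q = 1\<close> these compositions coincide for all \<open>i\<close>, so the sum over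
    \<open>i\<close> has to be the outer one.\<close>
  also have "\<dots> = (\<Sum>i<p. \<Sum>r\<in>compositions p N. sT ((-1) ^ sign_exponent p r) (t r i))"
    by (rule sum.swap)
  also have "\<dots> = (\<Sum>i<p. if N = p + q - 1
      then sT ((-1) ^ (i * (q + 1))) (t ((replicate p 1)[i := q]) i) else 0)"
  proof (rule sum.cong[OF refl])
    fix i
    assume i: "i \<in> {..<p}"
    let ?\<rho> = "(replicate p 1)[i := q]"
    have "(\<Sum>r\<in>compositions p N. sT ((-1) ^ sign_exponent p r) (t r i)) =
        (if ?\<rho> \<in> compositions p N then sT ((-1) ^ sign_exponent p ?\<rho>) (t ?\<rho> i) else 0)"
      using finite_compositions i p
      by (intro sum_single_support) (auto simp: t_zero)
    also have "\<dots> = (if N = p + q - 1 then sT ((-1) ^ sign_exponent p ?\<rho>) (t ?\<rho> i) else 0)"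
      using i q by (simp only: update_ones_in_compositions_iff lessThan_iff)
    also have "sT ((-1) ^ sign_exponent p ?\<rho>) (t ?\<rho> i) = sT ((-1) ^ (i * (q + 1))) (t ?\<rho> i)"
      using i by (intro T.scale_minus_one_power_cong even_sign_exponent) auto
    finally show "(\<Sum>r\<in>compositions p N. sT ((-1) ^ sign_exponent p r) (t r i)) =
      (if N = p + q - 1 then sT ((-1) ^ (i * (q + 1))) (t ?\<rho> i) else 0)" .
  qed
  \<comment> \<open>The condition \<open>p \<in> {2..N}\<close> follows from
    \<open>N = p + q - 1\<close>, since \<open>p \<ge> 2\<close> and
    \<open>q \<ge> 1\<close>.\<close>
  finally show ?thesis
    unfolding t_def using p q by auto
qed

text \<open>With both cochains at children the root carries \<open>\<beta>\<close>, which leaves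
  only \<open>Nu 2\<close>. The supports then fix both parts, and the exponent
  \<open>r ! 0 * (r ! 1 + 1)\<close> becomes \<open>(n - 1) * m\<close> or
  \<open>(m - 1) * n\<close> according to the order.\<close>

lemma child_sum:
  fixes ts
  defines "\<gamma> \<equiv> \<lambda>r v w. gamma (redecorate (nu_tree r) (decoration v w)) ts"
  shows "(\<Sum>l=2..N. \<Sum>r\<in>compositions l N. sT ((-1) ^ sign_exponent l r)
      (\<Sum>i<length r. \<Sum>j\<in>{..<length r} - {i}. \<gamma> r [i] [j])) =
    (if N = n + m - 2
     then sT ((-1) ^ ((n - 1) * m)) (\<gamma> [n - 1, m - 1] [0] [1]) +
       sT ((-1) ^ ((m - 1) * n)) (\<gamma> [m - 1, n - 1] [1] [0])
     else 0)"
proof -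
  have \<gamma>_zero: "\<gamma> r v w = 0"
    if "2 \<le> length r" "v \<noteq> []" "w \<noteq> []"
      "length r \<noteq> 2 \<or> (\<exists>i<length r. decoration v w [i] (Ff (r ! i)) = (\<lambda>_. 0))" for r v w
  proof -
    have "multilinear sT sT (length r) (decoration v w [] (Nu (length r)))"
      using that(1) multilinear_decoration[of "Nu (length r)" v w "[]"] by simp
    moreover have "decoration v w [] (Nu (length r)) = (\<lambda>_. 0) \<or>
      (\<exists>i<length r. decoration v w [i] (Ff (r ! i)) = (\<lambda>_. 0))"
      using that by (cases "length r = 2") (simp_all add: decoration_def)
    ultimately show ?thesis
      unfolding \<gamma>_def by (rule gamma_nu_tree_zero)
  qed
  have Ff_zero: "\<theta>e (Ff k) = (\<lambda>_. 0)" if "1 \<le> k" "k \<noteq> n - 1" for k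
    using that n by (intro cochain_zero[OF \<theta>]) auto
  have Ff_zero': "\<omega>e (Ff k) = (\<lambda>_. 0)" if "1 \<le> k" "k \<noteq> m - 1" for k
    using that m by (intro cochain_zero[OF \<omega>]) auto
  \<comment> \<open>Here \<open>a\<close> and \<open>b\<close> are the arities supporting the
    decorations of the left and the right child; both orders of \<open>\<theta>\<close> and
    \<open>\<omega>\<close> are instances.\<close>
  have single: "(\<Sum>r\<in>compositions 2 N. sT ((-1) ^ sign_exponent 2 r) (\<gamma> r v w)) =
      (if N = a + b then sT ((-1) ^ (a * (b + 1))) (\<gamma> [a, b] v w) else 0)"
    if vw: "v \<noteq> []" "w \<noteq> []" and ab: "1 \<le> a" "1 \<le> b"
      and D: "\<And>k. 1 \<le> k \<Longrightarrow> k \<noteq> a \<Longrightarrow> decoration v w [0] (Ff k) = (\<lambda>_. 0)"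
        "\<And>k. 1 \<le> k \<Longrightarrow> k \<noteq> b \<Longrightarrow> decoration v w [1] (Ff k) = (\<lambda>_. 0)" for v w a b
  proof -
    have "\<gamma> r v w = 0" if r2: "r \<in> compositions 2 N" "r \<noteq> [a, b]" for r
    proof -
      obtain x y where r: "r = [x, y]" "1 \<le> x" "1 \<le> y"
        using r2(1) by (auto simp: numeral_2_eq_2 length_Suc_conv)
      then have "x \<noteq> a \<or> y \<noteq> b"
        using r2(2) r by auto
      then have "\<exists>i<length r. decoration v w [i] (Ff (r ! i)) = (\<lambda>_. 0)"
        using r D by (auto simp: less_Suc_eq)
      then show ?thesis
        using vw r by (intro \<gamma>_zero) auto
    qed
    then have "(\<Sum>r\<in>compositions 2 N. sT ((-1) ^ sign_exponent 2 r) (\<gamma> r v w)) =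
      (if [a, b] \<in> compositions 2 N then sT ((-1) ^ sign_exponent 2 [a, b]) (\<gamma> [a, b] v w) else 0)"
      by (intro sum_single_support finite_compositions) auto
    then show ?thesis
      using ab by (auto simp: sign_exponent_pair)
  qed
  have "(\<Sum>l=2..N. \<Sum>r\<in>compositions l N. sT ((-1) ^ sign_exponent l r)
      (\<Sum>i<length r. \<Sum>j\<in>{..<length r} - {i}. \<gamma> r [i] [j])) =
    (if 2 \<in> {2..N} then \<Sum>r\<in>compositions 2 N. sT ((-1) ^ sign_exponent 2 r)
      (\<Sum>i<length r. \<Sum>j\<in>{..<length r} - {i}. \<gamma> r [i] [j]) else 0)"
    by (intro sum_single_support) (auto simp: \<gamma>_zero intro!: sum.neutral)
  also have "(\<Sum>r\<in>compositions 2 N. sT ((-1) ^ sign_exponent 2 r)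
      (\<Sum>i<length r. \<Sum>j\<in>{..<length r} - {i}. \<gamma> r [i] [j])) =
    (\<Sum>r\<in>compositions 2 N. sT ((-1) ^ sign_exponent 2 r) (\<gamma> r [0] [1]) +
      sT ((-1) ^ sign_exponent 2 r) (\<gamma> r [1] [0]))"
  proof (rule sum.cong[OF refl])
    fix r
    assume "r \<in> compositions 2 N"
    then have "{..<length r} = {0, 1}"
      by auto
    moreover have "{0, 1} - {0} = {1::nat}" "{0, 1} - {1} = {0::nat}"
      by auto
    ultimately have "(\<Sum>i<length r. \<Sum>j\<in>{..<length r} - {i}. \<gamma> r [i] [j]) = \<gamma> r [0] [1] + \<gamma> r [1] [0]"
      by simp
    then show "sT ((-1) ^ sign_exponent 2 r) (\<Sum>i<length r. \<Sum>j\<in>{..<length r} - {i}. \<gamma> r [i] [j]) =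
      sT ((-1) ^ sign_exponent 2 r) (\<gamma> r [0] [1]) + sT ((-1) ^ sign_exponent 2 r) (\<gamma> r [1] [0])"
      by (simp only: T.scale_right_distrib)
  qed
  also have "\<dots> = (if N = (n - 1) + (m - 1)
      then sT ((-1) ^ ((n - 1) * m)) (\<gamma> [n - 1, m - 1] [0] [1]) else 0) +
    (if N = (m - 1) + (n - 1)
      then sT ((-1) ^ ((m - 1) * n)) (\<gamma> [m - 1, n - 1] [1] [0]) else 0)"
    unfolding sum.distrib
    using single[of "[0]" "[1]" "n - 1" "m - 1"] single[of "[1]" "[0]" "m - 1" "n - 1"] n m
    by (simp add: decoration_def Ff_zero Ff_zero')
  finally show ?thesis
    using n m by auto
qed

text \<open>Every child other than \<open>i\<close> is \<open>Ff 1\<close> decorated by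
  \<open>\<beta>\<close>, that is by \<open>g\<close>; these are the copies of \<open>g\<close> in
  \<open>circ_along\<close>. Children count from 0 and positions from 1, whence
  \<open>i + 1\<close>.\<close>

lemma root_value:
  assumes F: "F (Nu p) = emb_VV \<alpha>" and G: "G (Ff q) = emb_UV \<psi>"
    and \<alpha>: "multilinear sV sV p \<alpha>" and \<psi>: "multilinear sU sV q \<psi>" and i: "i < p" and q: "1 \<le> q"
  shows "gamma (redecorate (nu_tree ((replicate p 1)[i := q])) (root_decoration F G i)) ts =
    emb_UV (circ_along g \<alpha> (i + 1) q \<psi>) ts"
proof (cases "length ts = p + q - 1")
  case True
  let ?\<rho> = "(replicate p 1)[i := q]"
  have \<rho>: "?\<rho> = replicate i 1 @ q # replicate (p - Suc i) 1"
    using i by (simp add: upd_conv_take_nth_drop)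
  have split: "split_list_by ?\<rho> ts =
      map (\<lambda>x. [x]) (take i ts) @ take q (drop i ts) # map (\<lambda>x. [x]) (drop (i + q) ts)"
    unfolding \<rho> using True i by (simp add: split_list_by_append split_list_by_ones add.commute)
  have sum: "length ts = sum_list ?\<rho>"
    unfolding \<rho> using True i by simp
  \<comment> \<open>Second components suffice, because \<open>emb_VV\<close> reads nothing else of
    its arguments.\<close>
  have "map (\<lambda>k. snd (root_decoration F G i [k] (Ff (?\<rho> ! k)) (split_list_by ?\<rho> ts ! k))) [0..<p] =
    map g (take i (map fst ts)) @ \<psi> (take q (drop i (map fst ts))) # map g (drop (i + q) (map fst ts))"
  proof (rule nth_equalityI)
    fix k
    assume "k < length (map (\<lambda>k. snd (root_decoration F G i [k] (Ff (?\<rho> ! k)) (split_list_by ?\<rho> ts ! k))) [0..<p])"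
    then have k: "k < p" by simp
    consider "k < i" | "k = i" | "i < k" by linarith
    then show "map (\<lambda>k. snd (root_decoration F G i [k] (Ff (?\<rho> ! k)) (split_list_by ?\<rho> ts ! k))) [0..<p] ! k =
      (map g (take i (map fst ts)) @ \<psi> (take q (drop i (map fst ts))) # map g (drop (i + q) (map fst ts))) ! k"
      unfolding split using k i True q
      by cases
        (auto simp: root_decoration_def G emb_UV_def nth_append nth_Cons' take_map drop_map)
  qed (use True i q in auto)
  moreover have "gamma (redecorate (nu_tree ?\<rho>) (root_decoration F G i)) ts = emb_VV \<alpha>
      (map (\<lambda>k. root_decoration F G i [k] (Ff (?\<rho> ! k)) (split_list_by ?\<rho> ts ! k)) [0..<p])"
    unfolding gamma_nu_tree[OF sum] by (simp add: root_decoration_def F)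
  ultimately show ?thesis
    by (simp only: emb_VV_def emb_UV_def circ_along_def map_map comp_def add_diff_cancel_right')
next
  case False
  have "length ts \<noteq> sum_list ((replicate p 1)[i := q])"
    using False i by (simp add: sum_list_update)
  then have "gamma (redecorate (nu_tree ((replicate p 1)[i := q])) (root_decoration F G i)) ts = 0"
    by (intro gamma_wrong_length) (simp only: leaves_redecorate leaves_nu_tree not_False_eq_True)
  moreover have "circ_along g \<alpha> (i + 1) q \<psi> (map fst ts) = 0"
    using False i q by (intro circ_along_wrong_length[OF \<alpha> \<psi>]) auto
  ultimately show ?thesis
    by (simp add: emb_UV_def zero_prod_def)
qed

text \<open>The root is the product of \<open>V\<close>, so the composite multiplies the values on
  the first \<open>a\<close> and the last \<open>b\<close> inputs.\<close>

lemma child_value: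
  assumes D: "D [] (Nu 2) = beta_gen g (Nu 2)" "D [0] (Ff a) = emb_UV \<phi>" "D [1] (Ff b) = emb_UV \<psi>"
    and \<phi>: "multilinear sU sV a \<phi>" and \<psi>: "multilinear sU sV b \<psi>"
  shows "gamma (redecorate (nu_tree [a, b]) D) ts = emb_UV (cup a \<phi> \<psi>) ts"
proof (cases "length ts = sum_list [a, b]")
  case True
  have "gamma (redecorate (nu_tree [a, b]) D) ts =
      D [] (Nu 2) [D [0] (Ff a) (take a ts), D [1] (Ff b) (drop a ts)]"
    unfolding gamma_nu_tree[OF True] using True by (simp add: numeral_2_eq_2)
  then show ?thesis
    unfolding D by (simp add: emb_VV_def emb_UV_def cup_def take_map drop_map)
next
  case False
  then have "gamma (redecorate (nu_tree [a, b]) D) ts = 0"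
    by (intro gamma_wrong_length) (simp only: leaves_redecorate leaves_nu_tree not_False_eq_True)
  moreover have "cup a \<phi> \<psi> (map fst ts) = 0"
    using False by (intro cup_wrong_length[OF \<phi> \<psi>]) auto
  ultimately show ?thesis
    by (simp add: emb_UV_def zero_prod_def)
qed

end


section \<open>Cochains of the deformation complex\<close>

text \<open>Entry \<open>k\<close> of the permuted list is entry \<open>inv \<sigma> k\<close> of
  the original. A varying input \<open>i\<close> thus becomes a varying slot
  \<open>\<sigma> i\<close>, which carries multilinearity over to \<open>act_End\<close>.\<close>

lemma permute_list_update:
  assumes "\<sigma> permutes {..<length xs}"
  shows "permute_list (inv \<sigma>) (xs[i := x]) = (permute_list (inv \<sigma>) xs)[\<sigma> i := x]"
proof (rule nth_equalityI)
  fix k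
  assume "k < length (permute_list (inv \<sigma>) (xs[i := x]))"
  then have k: "k < length xs" by simp
  have inv: "inv \<sigma> permutes {..<length xs}"
    using assms by (rule permutes_inv)
  then have "inv \<sigma> k < length xs"
    using k permutes_in_image by fastforce
  moreover have "inv \<sigma> k = i \<longleftrightarrow> k = \<sigma> i"
    using permutes_inv_eq[OF assms] by auto
  ultimately show "permute_list (inv \<sigma>) (xs[i := x]) ! k = (permute_list (inv \<sigma>) xs)[\<sigma> i := x] ! k"
    using k inv by (auto simp: permute_list_nth nth_list_update)
qed simp

lemma map2_replicate: "length xs = k \<Longrightarrow> map2 f (replicate k c) xs = map (f c) xs"
  by (rule nth_equalityI) simp_all

lemma inputs_replicate: "\<exists>c. inputs e = replicate (arity e) c"
  by (cases e) auto

lemma proj_add: "proj d (x + y) = proj d x + (proj d y :: 'a::monoid_add \<times> 'b::monoid_add)"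
  by (cases d; cases x; cases y) simp_all

lemma proj_zero: "proj d 0 = 0"
  by (cases d) (simp_all add: zero_prod_def)

lemma proj_sum: "proj d (\<Sum>a\<in>A. f a) = (\<Sum>a\<in>A. proj d (f a))"
  by (induction A rule: infinite_finite_induct) (simp_all add: proj_add proj_zero)

lemma fst_proj_B [simp]: "fst (proj B x) = fst x" and snd_proj_W [simp]: "snd (proj W x) = snd x"
  by (cases x; simp)+

lemma act_E_eq_sum:
  "act_E x \<tau> = (\<Sum>b\<in>Poly_Mapping.keys x.
    Poly_Mapping.single (fst b, snd b \<circ> \<tau>) (Poly_Mapping.lookup x b))"
  by (simp add: act_E_def case_prod_unfold)

section \<open>Equivariant extension from generators\<close>

context algebra_morphism
begin

lemma proj_scaleT: "proj d (sT c x) = sT c (proj d x)"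
  by (cases d; cases x) (simp_all add: scaleT_def)

lemma End_T_sum:
  assumes "\<And>a. a \<in> A \<Longrightarrow> \<phi> a \<in> End_T sU sV cs d"
  shows "(\<lambda>xs. \<Sum>a\<in>A. sT (c a) (\<phi> a xs)) \<in> End_T sU sV cs d"
  using assms
  by (auto simp: End_T_def proj_sum proj_scaleT intro!: TT.multilinear_sum TT.multilinear_scale)

text \<open>For a constant list of input colors the color projections commute with permuting the
  inputs. This case suffices, the inputs of a generator being all of one color.\<close>

lemma End_T_act_End:
  assumes \<phi>: "\<phi> \<in> End_T sU sV (replicate k c) d" and \<sigma>: "\<sigma> permutes {..<k}"
  shows "act_End \<phi> \<sigma> \<in> End_T sU sV (replicate k c) d"
proof -
  have ml: "multilinear sT sT k \<phi>"
    using End_T_multilinear[OF \<phi>] by simp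
  have "multilinear sT sT k (act_End \<phi> \<sigma>)"
    unfolding multilinear_def
  proof (intro conjI allI impI)
    fix xs :: "('u \<times> 'v) list" and i
    assume xs: "length xs = k \<and> i < k"
    then have "\<sigma> i < k"
      using \<sigma> permutes_in_image by fastforce
    then show "Vector_Spaces.linear sT sT (\<lambda>x. act_End \<phi> \<sigma> (xs[i := x]))"
      using xs \<sigma> by (auto simp: act_End_def permute_list_update intro!: multilinear_linear[OF ml])
  qed (simp add: act_End_def multilinear_wrong_length[OF ml])
  moreover have "act_End \<phi> \<sigma> (map2 proj (replicate k c) xs) = act_End \<phi> \<sigma> xs" if "length xs = k" for xs
  proof -
    have "inv \<sigma> permutes {..<length xs}"
      using permutes_inv[OF \<sigma>] that by simp
    then have "act_End \<phi> \<sigma> (map2 proj (replicate k c) xs) =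
        \<phi> (map2 proj (replicate k c) (permute_list (inv \<sigma>) xs))"
      using that by (simp add: act_End_def map2_replicate permute_list_map)
    then show ?thesis
      using \<phi> that by (simp add: End_T_def act_End_def)
  qed
  ultimately show ?thesis
    using \<phi> by (simp add: End_T_def act_End_def)
qed

text \<open>The inverse in \<open>act_End\<close> reverses compositions and so makes it a right
  action. On lists of length other than \<open>k\<close> both sides vanish.\<close>

lemma act_End_act_End:
  assumes \<phi>: "multilinear sT sT k \<phi>" and \<sigma>: "\<sigma> permutes {..<k}" and \<tau>: "\<tau> permutes {..<k}"
  shows "act_End (act_End \<phi> \<sigma>) \<tau> = act_End \<phi> (\<sigma> \<circ> \<tau>)"
proof
  fix xs
  show "act_End (act_End \<phi> \<sigma>) \<tau> xs = act_End \<phi> (\<sigma> \<circ> \<tau>) xs"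
  proof (cases "length xs = k")
    case True
    have "inv (\<sigma> \<circ> \<tau>) = inv \<tau> \<circ> inv \<sigma>"
      using \<sigma> \<tau> by (intro o_inv_distrib) (auto intro: permutes_bij)
    then show ?thesis
      using True permutes_inv[OF \<sigma>] by (simp add: act_End_def permute_list_compose)
  qed (simp add: act_End_def multilinear_wrong_length[OF \<phi>])
qed

text \<open>The bimodule is free on the generators, so color-preserving values on them determine a
  cochain. Equivariance reduces to the right action law, and the support condition is tested on
  generators.\<close>

lemma extend_in_def_complex:
  assumes a: "\<And>e. e \<in> generators \<Longrightarrow> a e \<in> End_T sU sV (inputs e) (out_color e)"
    and zero: "\<And>e. e \<in> generators \<Longrightarrow> degree e + 1 \<noteq> p \<Longrightarrow> a e = (\<lambda>_. 0)"
  shows "extend sT a \<in> def_complex sU sV p"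
proof -
  have E: "fst b \<in> generators \<and> snd b permutes {..<arity (fst b)} \<and> inputs (fst b) = cs \<and> out_color (fst b) = d"
    if "x \<in> E cs d" "b \<in> Poly_Mapping.keys x" for cs d b and x :: "'k bimod"
    using that by (auto simp: E_def)
  have "extend sT a x \<in> End_T sU sV cs d" if "x \<in> E cs d" for cs d x
    unfolding extend_def case_prod_unfold
  proof (rule End_T_sum)
    fix b
    assume "b \<in> Poly_Mapping.keys x"
    note b = E[OF that this]
    obtain c where c: "inputs (fst b) = replicate (arity (fst b)) c"
      using inputs_replicate by blast
    have "a (fst b) \<in> End_T sU sV (replicate (arity (fst b)) c) d"
      using a[of "fst b"] b c by auto
    then have "act_End (a (fst b)) (snd b) \<in> End_T sU sV (replicate (arity (fst b)) c) d"
      using b by (intro End_T_act_End) auto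
    then show "act_End (a (fst b)) (snd b) \<in> End_T sU sV cs d"
      using b c by auto
  qed
  moreover have "extend sT a (act_E x \<tau>) = act_End (extend sT a x) \<tau>"
    if x: "x \<in> E cs d" and \<tau>: "\<tau> permutes {..<length cs}" for cs d x \<tau>
  proof
    fix ts
    have "extend sT a (act_E x \<tau>) ts =
      (\<Sum>b\<in>Poly_Mapping.keys x. sT (Poly_Mapping.lookup x b) (act_End (a (fst b)) (snd b \<circ> \<tau>) ts))"
      by (simp add: extend_eq_lin_ext act_E_eq_sum T.lin_ext_sum)
    also have "\<dots> = (\<Sum>b\<in>Poly_Mapping.keys x.
        sT (Poly_Mapping.lookup x b) (act_End (act_End (a (fst b)) (snd b)) \<tau> ts))"
    proof (rule sum.cong[OF refl])
      fix b
      assume "b \<in> Poly_Mapping.keys x"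
      note b = E[OF x this]
      then show "sT (Poly_Mapping.lookup x b) (act_End (a (fst b)) (snd b \<circ> \<tau>) ts) =
        sT (Poly_Mapping.lookup x b) (act_End (act_End (a (fst b)) (snd b)) \<tau> ts)"
        using \<tau> act_End_act_End[OF End_T_multilinear[OF a]] by auto
    qed
    also have "\<dots> = act_End (extend sT a x) \<tau> ts"
      by (simp add: act_End_def extend_def case_prod_unfold)
    finally show "extend sT a (act_E x \<tau>) ts = act_End (extend sT a x) \<tau> ts" .
  qed
  ultimately show ?thesis
    unfolding def_complex_def
    by (auto simp: extend_gen_elt zero extend_eq_lin_ext T.lin_ext_add T.lin_ext_map_scale)
qed

end

section \<open>The three components of \<open>l2\<close> and its degree\<close>

context cochain_pair
begin

lemma components:
  "\<theta>e (Mu n) = emb_UU \<theta>U" "\<theta>e (Nu n) = emb_VV \<theta>V" "\<theta>e (Ff (n - 1)) = emb_UV \<theta>g"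
  "\<omega>e (Mu m) = emb_UU \<omega>U" "\<omega>e (Nu m) = emb_VV \<omega>V" "\<omega>e (Ff (m - 1)) = emb_UV \<omega>g"
  using \<theta>_corr \<omega>_corr by (simp_all add: corresponds_def)

lemma multilinear_components:
  "multilinear sV sV n \<theta>V" "multilinear sU sV (n - 1) \<theta>g"
  "multilinear sV sV m \<omega>V" "multilinear sU sV (m - 1) \<omega>g"
  using \<theta>_GS \<omega>_GS by (simp_all add: C_GS_def)

text \<open>Stating the value for every \<open>N\<close> pays off in the zero branch, which later
  yields the degree of the resulting cochain.\<close>

lemma l2_Mu:
  "l2 (Mu N) = (if N = n + m - 1 then emb_UU (\<lambda>xs.
      - (\<Sum>s=1..n. sU ((-1) ^ ((s + 1) * (m + 1))) (circ \<theta>U s m \<omega>U xs))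
      - sU ((-1) ^ (n + m)) (\<Sum>s=1..m. sU ((-1) ^ ((s + 1) * (n + 1))) (circ \<omega>U s n \<theta>U xs)))
    else (\<lambda>_. 0))"
  unfolding fun_eq_iff
  by (simp add: l2_Mu_or_Nu[of Mu] components circ_emb_UU_emb_UU prod_eq_iff fst_sum snd_sum
      emb_UU_def sum.neutral del: power_Suc)

lemma l2_Nu:
  "l2 (Nu N) = (if N = n + m - 1 then emb_VV (\<lambda>xs.
      - (\<Sum>s=1..n. sV ((-1) ^ ((s + 1) * (m + 1))) (circ \<theta>V s m \<omega>V xs))
      - sV ((-1) ^ (n + m)) (\<Sum>s=1..m. sV ((-1) ^ ((s + 1) * (n + 1))) (circ \<omega>V s n \<theta>V xs)))
    else (\<lambda>_. 0))"
  unfolding fun_eq_iff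
  by (simp add: l2_Mu_or_Nu[of Nu] components circ_emb_VV_emb_VV prod_eq_iff fst_sum snd_sum
      emb_VV_def sum.neutral del: power_Suc)

text \<open>Children of a vertex are counted from 0, positions in a partial composition from
  1.\<close>

lemma root_sum_shift:
  "(\<Sum>i<p. sT ((-1) ^ (i * k)) (f (i + 1))) = (\<Sum>i=1..p. sT ((-1) ^ ((i - 1) * k)) (f i))"
  by (rule sum.reindex_bij_witness[of _ "\<lambda>i. i - 1" "\<lambda>i. i + 1"]) auto

lemma lin_ext_boundary_Ff:
  "lin_ext sT f (boundary (Ff N)) =
    - (\<Sum>l=2..N. \<Sum>r\<in>compositions l N. sT ((-1) ^ sign_exponent l r) (f (nu_tree r)))
    - (\<Sum>(i, j)\<in>{(i, j). i + j = N + 1 \<and> 1 \<le> i \<and> 2 \<le> j}. \<Sum>s=0..N - j.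
         sT ((-1) ^ (i + s * (j + 1))) (f (graft (Ff i) (s + 1) (Mu j))))"
proof -
  \<comment> \<open>\<open>nu_tree\<close> takes the arity of its root from \<open>r\<close>, whose
    length is \<open>l\<close> on \<open>compositions l N\<close>.\<close>
  have "(\<Sum>l=2..N. \<Sum>r\<in>compositions l N. sT ((-1) ^ sign_exponent l r) (f (Node (Nu l) (map (\<lambda>a. corolla (Ff a)) r)))) =
    (\<Sum>l=2..N. \<Sum>r\<in>compositions l N. sT ((-1) ^ sign_exponent l r) (f (nu_tree r)))"
    by (intro sum.cong refl) auto
  then show ?thesis
    unfolding boundary.simps T.lin_ext_diff T.lin_ext_minus lin_ext_signed_sum
    by (simp only: T.lin_ext_sum T.lin_ext_single sign_exponent_def)
qed

text \<open>The grafts contribute \<open>X\<close> and \<open>Y\<close>. Graphs with root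
  \<open>Nu l\<close> contribute \<open>Z1\<close> and \<open>Z2\<close> when a cochain sits at the
  root, and \<open>K1\<close> and \<open>K2\<close> when both sit at children. All six occur at the
  same \<open>N\<close>.\<close>

lemma l2_Ff:
  "l2 (Ff N) = (if N = n + m - 2 then emb_UV (\<lambda>xs.
      - (\<Sum>s=1..n - 1. sV ((-1) ^ ((s + 1) * (m + 1))) (circ \<theta>g s m \<omega>U xs))
      - sV ((-1) ^ (n + m)) (\<Sum>s=1..m - 1. sV ((-1) ^ ((s + 1) * (n + 1))) (circ \<omega>g s n \<theta>U xs))
      + sV ((-1) ^ n) (\<Sum>i=1..n. sV ((-1) ^ ((i - 1) * m)) (circ_along g \<theta>V i (m - 1) \<omega>g xs))
      + (\<Sum>j=1..m. sV ((-1) ^ (j * n)) (circ_along g \<omega>V j (n - 1) \<theta>g xs))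
      + sV ((-1) ^ (n * m + n + m)) (cup (n - 1) \<theta>g \<omega>g xs)
      + sV ((-1) ^ (n * m)) (cup (m - 1) \<omega>g \<theta>g xs))
    else (\<lambda>_. 0))"
proof
  fix ts
  define X where "X = (\<Sum>s=1..n - 1. sT ((-1) ^ ((s + 1) * (m + 1))) (emb_UV (circ \<theta>g s m \<omega>U) ts))"
  define Y where "Y = (\<Sum>s=1..m - 1. sT ((-1) ^ ((s + 1) * (n + 1))) (emb_UV (circ \<omega>g s n \<theta>U) ts))"
  define Z1 where "Z1 = (\<Sum>i=1..n. sT ((-1) ^ ((i - 1) * m)) (emb_UV (circ_along g \<theta>V i (m - 1) \<omega>g) ts))"
  define Z2 where "Z2 = (\<Sum>j=1..m. sT ((-1) ^ ((j - 1) * n)) (emb_UV (circ_along g \<omega>V j (n - 1) \<theta>g) ts))"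
  define K1 where "K1 = emb_UV (cup (n - 1) \<theta>g \<omega>g) ts"
  define K2 where "K2 = emb_UV (cup (m - 1) \<omega>g \<theta>g) ts"
  let ?C = "N = n + m - 2"
  have grafts: "(\<Sum>(i, j)\<in>{(i, j). i + j = N + 1 \<and> 1 \<le> i \<and> 2 \<le> j}. \<Sum>s=0..N - j.
      sT ((-1) ^ (i + s * (j + 1))) (pair_value (graft (Ff i) (s + 1) (Mu j)) ts)) =
    (if n - 1 + m = N + 1 then sT ((-1) ^ (n - 1)) X else 0) +
    (if m - 1 + n = N + 1 then sT ((-1) ^ (m - 1)) Y else 0)"
    unfolding X_def Y_def circ_emb_UV_emb_UU[symmetric] components[symmetric]
    by (rule pair_value_graft_sum)
      (use n m in \<open>auto intro!: cochain_zero[OF \<theta>] cochain_zero[OF \<omega>]\<close>)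
  have Nu_zero: "\<theta>e (Nu k) = (\<lambda>_. 0)" if "2 \<le> k" "k \<noteq> n" for k
    using that n by (intro cochain_zero[OF \<theta>]) auto
  have Nu_zero': "\<omega>e (Nu k) = (\<lambda>_. 0)" if "2 \<le> k" "k \<noteq> m" for k
    using that m by (intro cochain_zero[OF \<omega>]) auto
  have Ff_zero: "\<theta>e (Ff k) = (\<lambda>_. 0)" if "1 \<le> k" "k \<noteq> n - 1" for k
    using that n by (intro cochain_zero[OF \<theta>]) auto
  have Ff_zero': "\<omega>e (Ff k) = (\<lambda>_. 0)" if "1 \<le> k" "k \<noteq> m - 1" for k
    using that m by (intro cochain_zero[OF \<omega>]) auto
  have ml: "multilinear sT sT k (\<theta>e (Nu k))" "multilinear sT sT k (\<omega>e (Nu k))" if "2 \<le> k" for k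
    using that multilinear_\<theta>[of "Nu k"] multilinear_\<omega>[of "Nu k"] by auto
  have nm: "1 \<le> n - 1" "1 \<le> m - 1" "m - 1 + 1 = m" "n - 1 + 1 = n"
    using n m by auto
  have root1: "(\<Sum>l=2..N. \<Sum>r\<in>compositions l N. sT ((-1) ^ sign_exponent l r)
      (\<Sum>i<length r. gamma (redecorate (nu_tree r) (root_decoration \<theta>e \<omega>e i)) ts)) = (if ?C then Z1 else 0)"
  proof -
    have "(\<Sum>i<n. sT ((-1) ^ (i * (m - 1 + 1)))
        (gamma (redecorate (nu_tree ((replicate n 1)[i := m - 1])) (root_decoration \<theta>e \<omega>e i)) ts)) =
      (\<Sum>i<n. sT ((-1) ^ (i * m)) (emb_UV (circ_along g \<theta>V (i + 1) (m - 1) \<omega>g) ts))"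
      using root_value[of \<theta>e n _ \<omega>e, OF components(2) components(6) multilinear_components(1,4) _ nm(2)]
      by (intro sum.cong refl) (simp only: nm lessThan_iff)
    also have "\<dots> = Z1"
      unfolding Z1_def by (rule root_sum_shift)
    moreover have "N = n + (m - 1) - 1 \<longleftrightarrow> ?C"
      using n m by auto
    ultimately show ?thesis
      by (subst root_sum[where p = n and q = "m - 1"]) (use Nu_zero Ff_zero' ml n nm in auto)
  qed
  have root2: "(\<Sum>l=2..N. \<Sum>r\<in>compositions l N. sT ((-1) ^ sign_exponent l r)
      (\<Sum>i<length r. gamma (redecorate (nu_tree r) (root_decoration \<omega>e \<theta>e i)) ts)) = (if ?C then Z2 else 0)"
  proof -
    have "(\<Sum>i<m. sT ((-1) ^ (i * (n - 1 + 1)))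
        (gamma (redecorate (nu_tree ((replicate m 1)[i := n - 1])) (root_decoration \<omega>e \<theta>e i)) ts)) =
      (\<Sum>i<m. sT ((-1) ^ (i * n)) (emb_UV (circ_along g \<omega>V (i + 1) (n - 1) \<theta>g) ts))"
      using root_value[of \<omega>e m _ \<theta>e, OF components(5) components(3) multilinear_components(3,2) _ nm(1)]
      by (intro sum.cong refl) (simp only: nm lessThan_iff)
    also have "\<dots> = Z2"
      unfolding Z2_def by (rule root_sum_shift)
    moreover have "N = m + (n - 1) - 1 \<longleftrightarrow> ?C"
      using n m by auto
    ultimately show ?thesis
      by (subst root_sum[where p = m and q = "n - 1"]) (use Nu_zero' Ff_zero ml m nm in auto)
  qed
  have "gamma (redecorate (nu_tree [n - 1, m - 1]) (decoration [0] [1])) ts = K1"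
    unfolding K1_def
    by (rule child_value[OF _ _ _ multilinear_components(2,4)]) (simp_all add: decoration_def components[simplified])
  moreover have "gamma (redecorate (nu_tree [m - 1, n - 1]) (decoration [1] [0])) ts = K2"
    unfolding K2_def
    by (rule child_value[OF _ _ _ multilinear_components(4,2)]) (simp_all add: decoration_def components[simplified])
  ultimately have children: "(\<Sum>l=2..N. \<Sum>r\<in>compositions l N. sT ((-1) ^ sign_exponent l r)
      (\<Sum>i<length r. \<Sum>j\<in>{..<length r} - {i}. gamma (redecorate (nu_tree r) (decoration [i] [j])) ts)) =
    (if ?C then sT ((-1) ^ ((n - 1) * m)) K1 + sT ((-1) ^ ((m - 1) * n)) K2 else 0)"
    by (simp only: child_sum)
  \<comment> \<open>In order: the prefactor times the signs of the two graft sums, the prefactor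
    alone for the root terms, and the prefactor times the two cup signs. The minus signs in
    \<open>boundary (Ff N)\<close> are applied separately.\<close>
  have sgn: "sT ((-1) ^ (n - 1)) (sT ((-1) ^ (n - 1)) x) = x"
    "sT ((-1) ^ (n - 1)) (sT ((-1) ^ (m - 1)) x) = sT ((-1) ^ (n + m)) x"
    "sT ((-1) ^ (n - 1)) x = - sT ((-1) ^ n) x"
    "sT ((-1) ^ (n - 1)) (sT ((-1) ^ ((n - 1) * m)) x) = - sT ((-1) ^ (n * m + n + m)) x"
    "sT ((-1) ^ (n - 1)) (sT ((-1) ^ ((m - 1) * n)) x) = - sT ((-1) ^ (n * m)) x" for x
    using n m by (simp_all add: minus_one_power_iff)
  \<comment> \<open>The sign \<open>(-1) ^ n\<close> is absorbed into the second root sum, as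
    \<open>n + (j - 1) * n = j * n\<close> for \<open>j \<ge> 1\<close>.\<close>
  have Z2: "sT ((-1) ^ n) Z2 = (\<Sum>j=1..m. sT ((-1) ^ (j * n)) (emb_UV (circ_along g \<omega>V j (n - 1) \<theta>g) ts))"
    unfolding Z2_def T.scale_sum_right T.scale_scale power_add[symmetric]
    by (intro sum.cong refl T.scale_minus_one_power_cong) (auto simp: algebra_simps)
  have "l2 (Ff N) ts = (if ?C then - X - sT ((-1) ^ (n + m)) Y + sT ((-1) ^ n) Z1 + sT ((-1) ^ n) Z2
      + sT ((-1) ^ (n * m + n + m)) K1 + sT ((-1) ^ (n * m)) K2 else 0)"
  proof -
    have C: "n - 1 + m = N + 1 \<longleftrightarrow> ?C" "m - 1 + n = N + 1 \<longleftrightarrow> ?C"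
      using n m by auto
    have "lin_ext sT (\<lambda>\<Gamma>. pair_value \<Gamma> ts) (boundary (Ff N)) =
      (if ?C then - (Z1 + Z2 + (sT ((-1) ^ ((n - 1) * m)) K1 + sT ((-1) ^ ((m - 1) * n)) K2))
        - (sT ((-1) ^ (n - 1)) X + sT ((-1) ^ (m - 1)) Y) else 0)"
      unfolding lin_ext_boundary_Ff pair_value_nu_tree T.scale_right_distrib sum.distrib
        root1 root2 children grafts C
      by simp
    then have "l2 (Ff N) ts = (if ?C then sT ((-1) ^ (n - 1))
        (- (Z1 + Z2 + (sT ((-1) ^ ((n - 1) * m)) K1 + sT ((-1) ^ ((m - 1) * n)) K2))
          - (sT ((-1) ^ (n - 1)) X + sT ((-1) ^ (m - 1)) Y)) else 0)"
      unfolding l2_eq by simp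
    also have "sT ((-1) ^ (n - 1))
        (- (Z1 + Z2 + (sT ((-1) ^ ((n - 1) * m)) K1 + sT ((-1) ^ ((m - 1) * n)) K2))
          - (sT ((-1) ^ (n - 1)) X + sT ((-1) ^ (m - 1)) Y)) =
      - X - sT ((-1) ^ (n + m)) Y + sT ((-1) ^ n) Z1 + sT ((-1) ^ n) Z2
      + sT ((-1) ^ (n * m + n + m)) K1 + sT ((-1) ^ (n * m)) K2"
      unfolding T.scale_right_distrib T.scale_right_diff_distrib T.scale_minus_right
      unfolding sgn(1,2,4,5)
      unfolding sgn(3)
      by (simp add: algebra_simps)
    finally show ?thesis .
  qed
  then show "l2 (Ff N) ts = (if N = n + m - 2 then emb_UV (\<lambda>xs.
      - (\<Sum>s=1..n - 1. sV ((-1) ^ ((s + 1) * (m + 1))) (circ \<theta>g s m \<omega>U xs))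
      - sV ((-1) ^ (n + m)) (\<Sum>s=1..m - 1. sV ((-1) ^ ((s + 1) * (n + 1))) (circ \<omega>g s n \<theta>U xs))
      + sV ((-1) ^ n) (\<Sum>i=1..n. sV ((-1) ^ ((i - 1) * m)) (circ_along g \<theta>V i (m - 1) \<omega>g xs))
      + (\<Sum>j=1..m. sV ((-1) ^ (j * n)) (circ_along g \<omega>V j (n - 1) \<theta>g xs))
      + sV ((-1) ^ (n * m + n + m)) (cup (n - 1) \<theta>g \<omega>g xs)
      + sV ((-1) ^ (n * m)) (cup (m - 1) \<omega>g \<theta>g xs))
    else (\<lambda>_. 0)) ts"
    unfolding Z2 X_def Y_def Z1_def K1_def K2_def
    by (simp add: prod_eq_iff fst_sum snd_sum emb_UV_def sum.neutral del: power_Suc)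
qed

text \<open>Colors are read off the explicit formulas, whose values are embedded components or zero;
  multilinearity comes from the individual graphs through \<open>multilinear_l2\<close>.\<close>

lemma l2_in_End_T:
  assumes "e \<in> generators"
  shows "l2 e \<in> End_T sU sV (inputs e) (out_color e)"
proof -
  have "proj B (emb_UU \<phi> xs) = emb_UU \<phi> xs" "proj W (emb_VV \<psi> xs) = emb_VV \<psi> xs" "proj W (emb_UV \<chi> xs) = emb_UV \<chi> xs"
    for \<phi> :: "'u list \<Rightarrow> 'u" and \<psi> :: "'v list \<Rightarrow> 'v" and \<chi> :: "'u list \<Rightarrow> 'v" and xs
    by (simp_all add: emb_UU_def emb_VV_def emb_UV_def)
  moreover have "emb_UU \<phi> (map (proj B) xs) = emb_UU \<phi> xs" "emb_VV \<psi> (map (proj W) xs) = emb_VV \<psi> xs"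
    "emb_UV \<chi> (map (proj B) xs) = emb_UV \<chi> xs"
    for \<phi> :: "'u list \<Rightarrow> 'u" and \<psi> :: "'v list \<Rightarrow> 'v" and \<chi> :: "'u list \<Rightarrow> 'v" and xs :: "('u \<times> 'v) list"
    by (simp_all add: emb_UU_def emb_VV_def emb_UV_def comp_def)
  ultimately show ?thesis
    using multilinear_l2[OF assms]
    by (cases e) (auto simp: End_T_def l2_Mu l2_Nu l2_Ff map2_replicate proj_zero)
qed

text \<open>\<open>l2\<close> can be nonzero only on \<open>Mu (n + m - 1)\<close>,
  \<open>Nu (n + m - 1)\<close> and \<open>Ff (n + m - 2)\<close>, and all three have degree
  \<open>n + m - 3\<close>.\<close>

lemma l_op_in_def_complex:
  "l_op sU sV g [(n - 1, \<theta>), (m - 1, \<omega>)] \<in> def_complex sU sV (n + m - 1 - 1)"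
  unfolding l_op_def l2_def[symmetric]
proof (rule extend_in_def_complex[OF l2_in_End_T])
  fix e
  assume "e \<in> generators" "degree e + 1 \<noteq> n + m - 1 - 1"
  then show "l2 e = (\<lambda>_. 0)"
    using n m by (cases e) (auto simp: l2_Mu l2_Nu l2_Ff)
qed

end

theorem theorem6p2:
  fixes sU :: "'k::field_char_0 \<Rightarrow> 'u::ring \<Rightarrow> 'u"
    and sV :: "'k \<Rightarrow> 'v::ring \<Rightarrow> 'v"
    and g :: "'u \<Rightarrow> 'v"
    and n m :: nat
    and \<theta> \<omega> :: "('k, 'u, 'v) cochain"
  assumes "algebra_morphism sU sV g"
    and "n \<ge> 2" and "m \<ge> 2"
    and "\<theta> \<in> def_complex sU sV (n - 1)"
    and "\<omega> \<in> def_complex sU sV (m - 1)"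
    and "(\<theta>U, \<theta>V, \<theta>g) \<in> C_GS sU sV n" and "corresponds n \<theta> (\<theta>U, \<theta>V, \<theta>g)"
    and "(\<omega>U, \<omega>V, \<omega>g) \<in> C_GS sU sV m" and "corresponds m \<omega> (\<omega>U, \<omega>V, \<omega>g)"
  shows "l_op sU sV g [(n - 1, \<theta>), (m - 1, \<omega>)] \<in> def_complex sU sV ((n + m - 1) - 1) \<and>
    l_op sU sV g [(n - 1, \<theta>), (m - 1, \<omega>)] (gen_elt (Mu (n + m - 1))) = emb_UU (\<lambda>xs.
      - (\<Sum>s=1..n. sU ((-1) ^ ((s + 1) * (m + 1))) (circ \<theta>U s m \<omega>U xs))
      - sU ((-1) ^ (n + m)) (\<Sum>s=1..m. sU ((-1) ^ ((s + 1) * (n + 1))) (circ \<omega>U s n \<theta>U xs))) \<and>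
    l_op sU sV g [(n - 1, \<theta>), (m - 1, \<omega>)] (gen_elt (Nu (n + m - 1))) = emb_VV (\<lambda>xs.
      - (\<Sum>s=1..n. sV ((-1) ^ ((s + 1) * (m + 1))) (circ \<theta>V s m \<omega>V xs))
      - sV ((-1) ^ (n + m)) (\<Sum>s=1..m. sV ((-1) ^ ((s + 1) * (n + 1))) (circ \<omega>V s n \<theta>V xs))) \<and>
    l_op sU sV g [(n - 1, \<theta>), (m - 1, \<omega>)] (gen_elt (Ff (n + m - 2))) = emb_UV (\<lambda>xs.
      - (\<Sum>s=1..n - 1. sV ((-1) ^ ((s + 1) * (m + 1))) (circ \<theta>g s m \<omega>U xs))
      - sV ((-1) ^ (n + m)) (\<Sum>s=1..m - 1. sV ((-1) ^ ((s + 1) * (n + 1))) (circ \<omega>g s n \<theta>U xs))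
      + sV ((-1) ^ n) (\<Sum>i=1..n. sV ((-1) ^ ((i - 1) * m)) (circ_along g \<theta>V i (m - 1) \<omega>g xs))
      + (\<Sum>j=1..m. sV ((-1) ^ (j * n)) (circ_along g \<omega>V j (n - 1) \<theta>g xs))
      + sV ((-1) ^ (n * m + n + m)) (cup (n - 1) \<theta>g \<omega>g xs)
      + sV ((-1) ^ (n * m)) (cup (m - 1) \<omega>g \<theta>g xs))"
proof -
  interpret cochain_pair sU sV g n m \<theta> \<omega> \<theta>U \<theta>V \<theta>g \<omega>U \<omega>V \<omega>g
    using assms by (simp add: cochain_pair_def cochain_pair_axioms_def)
  show ?thesis
    by (intro conjI l_op_in_def_complex)
      (simp_all only: l_op_def l2_def[symmetric] extend_gen_elt l2_Mu l2_Nu l2_Ff refl if_True)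
qed

end
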